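(* Let $(W,S)$ be a Coxeter system and let $I_\bullet=[I_0,\dots,I_d]$ be a singular expression. Put $$y_i=w_{I_i}w_{I_i\cap I_{i+1}}^{-1}\ (0\le i\le d-1),\qquad z_i=w_{I_{i-1}\cap I_i}^{-1}w_{I_i}\ (1\le i\le d),$$ and for $0\le k\le d$ let $$a_k:=y_0*y_1*\cdots*y_{k-1}*w_{I_k}*z_{k+1}*\cdots*z_{d-1}*z_d .$$ Say that the lengths add in $a_k$ if $a_k=y_0.y_1.\cdots.y_{k-1}.w_{I_k}.z_{k+1}.\cdots.z_{d-1}.z_d$, i.e. $a_k$ equals the ordinary group product of these factors and $\ell_W(a_k)$ is the sum of the lengths of the factors. The following are equivalent: (1) $I_\bullet$ is reduced. (2) The lengths add in $a_k$ for some $0\le k\le d$. (3) The lengths add in $a_k$ for all $0\le k\le d$.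
   Context: Let $(W,S)$ be a Coxeter system with identity $e$, length function $\ell_W$ and Bruhat order $\le$. For $I\subset S$ let $W_I$ be the parabolic subgroup generated by $I$; $I$ is finitary if $W_I$ is finite, and then $w_I$ is the longest element of $W_I$. For finitary $I,J$, a $(J,I)$-coset is a double coset $p\in W_J\backslash W/W_I$; it has a unique Bruhat-maximal element $\overline{p}$ and a unique Bruhat-minimal element $\underline{p}$. The $*$-product on $W$ is the associative product with $x*s=xs$ if $xs>x$ and $x*s=x$ if $xs<x$ ($s\in S$). The notation $w=x.y$ means $w=xy$ and $\ell_W(w)=\ell_W(x)+\ell_W(y)$. A (singular) expression is a sequence $[I_0,\dots,I_d]$ of finitary subsets of $S$, consecutive ones differing by adding or removing exactly one element of $S$. Its forward path is the sequence $p_0,\dots,p_d$ where $p_i$ is an $(I_0,I_i)$-coset, $e\in p_0$; if $I_i\subset I_{i+1}$, $p_{i+1}$ is the $(I_0,I_{i+1})$-coset containing $p_i$; if $I_i\supset I_{i+1}$, $p_{i+1}$ is the $(I_0,I_{i+1})$-coset containing $\overline{p_i}$. Put $K_i=I_0\cap\underline{p_i}I_i\underline{p_i}^{-1}$. The expression is reduced if for every $i$ with $I_i\subset I_{i+1}$ one has $\underline{p_i}=\underline{p_{i+1}}$ and $K_i=K_{i+1}$. *)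

theory Defs
  imports "HOL-Algebra.Generated_Groups" "HOL-Library.Extended_Nat"
begin

definition coxeter_matrix :: "'a set \<Rightarrow> ('a \<Rightarrow> 'a \<Rightarrow> enat) \<Rightarrow> bool" where
  "coxeter_matrix S m \<longleftrightarrow>
     (\<forall>s\<in>S. m s s = 1) \<and>
     (\<forall>s\<in>S. \<forall>t\<in>S. m s t = m t s) \<and>
     (\<forall>s\<in>S. \<forall>t\<in>S. s \<noteq> t \<longrightarrow> 2 \<le> m s t)"

text \<open>The congruence on words over \<open>S\<close> generated by the Coxeter relations \<open>(s t)^m(s,t) = 1\<close>
  for finite \<open>m(s,t)\<close>. No letters for inverses are needed: \<open>m(s,s) = 1\<close> gives \<open>s s = 1\<close>, so
  words over \<open>S\<close> modulo this congruence form the group presented by these generators and relations.\<close>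

inductive coxeter_cong :: "'a set \<Rightarrow> ('a \<Rightarrow> 'a \<Rightarrow> enat) \<Rightarrow> 'a list \<Rightarrow> 'a list \<Rightarrow> bool"
  for S :: "'a set" and m :: "'a \<Rightarrow> 'a \<Rightarrow> enat" where
  relation: "\<lbrakk>u \<in> lists S; v \<in> lists S; s \<in> S; t \<in> S; m s t = enat n\<rbrakk>
     \<Longrightarrow> coxeter_cong S m (u @ concat (replicate n [s, t]) @ v) (u @ v)"
| refl: "u \<in> lists S \<Longrightarrow> coxeter_cong S m u u"
| sym: "coxeter_cong S m u v \<Longrightarrow> coxeter_cong S m v u"
| trans: "\<lbrakk>coxeter_cong S m u v; coxeter_cong S m v w\<rbrakk> \<Longrightarrow> coxeter_cong S m u w"

text \<open>The set \<open>S\<close> is allowed to be infinite.\<close>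

locale coxeter_system = group W for W :: "('a, 'b) monoid_scheme" (structure) +
  fixes S :: "'a set"
  assumes S_closed: "S \<subseteq> carrier W"
    and S_generates: "generate W S = carrier W"
    and S_presentation: "\<exists>m. coxeter_matrix S m \<and>
      (\<forall>u\<in>lists S. \<forall>v\<in>lists S.
         foldr (\<otimes>) u \<one> = foldr (\<otimes>) v \<one> \<longleftrightarrow> coxeter_cong S m u v)"
begin

definition len :: "'a \<Rightarrow> nat" where
  "len w = (LEAST n. \<exists>u\<in>lists S. length u = n \<and> foldr (\<otimes>) u \<one> = w)"

definition reflections :: "'a set" where
  "reflections = {w \<otimes> s \<otimes> inv w | w s. w \<in> carrier W \<and> s \<in> S}"

definition bruhat_le :: "'a \<Rightarrow> 'a \<Rightarrow> bool" where
  "bruhat_le = (\<lambda>x y. x \<in> carrier W \<and> (\<exists>t\<in>reflections. y = x \<otimes> t \<and> len x < len y))\<^sup>*\<^sup>*"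

definition bruhat_less :: "'a \<Rightarrow> 'a \<Rightarrow> bool" where
  "bruhat_less x y \<longleftrightarrow> bruhat_le x y \<and> x \<noteq> y"

definition finitary :: "'a set \<Rightarrow> bool" where
  "finitary I \<longleftrightarrow> I \<subseteq> S \<and> finite (generate W I)"

definition longest :: "'a set \<Rightarrow> 'a" where
  "longest I = (THE w. w \<in> generate W I \<and> (\<forall>v\<in>generate W I. len v \<le> len w))"

definition double_cosets :: "'a set \<Rightarrow> 'a set \<Rightarrow> 'a set set" where
  "double_cosets J I = {(generate W J #> x) <#> generate W I | x. x \<in> carrier W}"

definition max_elt :: "'a set \<Rightarrow> 'a" where
  "max_elt p = (THE x. x \<in> p \<and> \<not> (\<exists>y\<in>p. bruhat_less x y))"

definition min_elt :: "'a set \<Rightarrow> 'a" where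
  "min_elt p = (THE x. x \<in> p \<and> \<not> (\<exists>y\<in>p. bruhat_less y x))"

text \<open>The unit is part of the characterisation of the \<open>*\<close>-product: associativity and the rule
  for \<open>x * s\<close> alone do not determine it when \<open>S\<close> has exactly one element. With the unit
  the product is unique on \<open>carrier W\<close>, so the choice in \<open>star\<close> is immaterial.\<close>

definition is_star_product :: "('a \<Rightarrow> 'a \<Rightarrow> 'a) \<Rightarrow> bool" where
  "is_star_product f \<longleftrightarrow>
     monoid \<lparr>carrier = carrier W, monoid.mult = f, one = \<one>\<rparr> \<and>
     (\<forall>x\<in>carrier W. \<forall>s\<in>S.
        (bruhat_less x (x \<otimes> s) \<longrightarrow> f x s = x \<otimes> s) \<and>
        (bruhat_less (x \<otimes> s) x \<longrightarrow> f x s = x))"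

definition star :: "'a \<Rightarrow> 'a \<Rightarrow> 'a" where
  "star = (SOME f. is_star_product f)"

text \<open>The expression \<open>[I\<^sub>0, \<dots>, I\<^sub>d]\<close> is given by \<open>d\<close> and a sequence \<open>I\<close>, whose
  terms beyond \<open>d\<close> are irrelevant.\<close>

definition singular_expression :: "nat \<Rightarrow> (nat \<Rightarrow> 'a set) \<Rightarrow> bool" where
  "singular_expression d I \<longleftrightarrow>
     (\<forall>i\<le>d. finitary (I i)) \<and>
     (\<forall>i<d. \<exists>s\<in>S. (s \<notin> I i \<and> I (Suc i) = insert s (I i)) \<or>
                  (s \<in> I i \<and> I (Suc i) = I i - {s}))"

primrec forward_path :: "(nat \<Rightarrow> 'a set) \<Rightarrow> nat \<Rightarrow> 'a set" where
  "forward_path I 0 = (THE p. p \<in> double_cosets (I 0) (I 0) \<and> \<one> \<in> p)"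
| "forward_path I (Suc i) =
     (if I i \<subset> I (Suc i)
      then THE p. p \<in> double_cosets (I 0) (I (Suc i)) \<and> forward_path I i \<subseteq> p
      else THE p. p \<in> double_cosets (I 0) (I (Suc i)) \<and> max_elt (forward_path I i) \<in> p)"

definition left_redundancy :: "(nat \<Rightarrow> 'a set) \<Rightarrow> nat \<Rightarrow> 'a set" where
  "left_redundancy I i =
     (let x = min_elt (forward_path I i) in I 0 \<inter> (\<lambda>s. x \<otimes> s \<otimes> inv x) ` I i)"

definition reduced_expression :: "nat \<Rightarrow> (nat \<Rightarrow> 'a set) \<Rightarrow> bool" where
  "reduced_expression d I \<longleftrightarrow>
     (\<forall>i<d. I i \<subset> I (Suc i) \<longrightarrow>
        min_elt (forward_path I i) = min_elt (forward_path I (Suc i)) \<and>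
        left_redundancy I i = left_redundancy I (Suc i))"

definition y_factor :: "(nat \<Rightarrow> 'a set) \<Rightarrow> nat \<Rightarrow> 'a" where
  "y_factor I i = longest (I i) \<otimes> inv (longest (I i \<inter> I (Suc i)))"

definition z_factor :: "(nat \<Rightarrow> 'a set) \<Rightarrow> nat \<Rightarrow> 'a" where
  "z_factor I i = inv (longest (I (i - 1) \<inter> I i)) \<otimes> longest (I i)"

text \<open>The list \<open>y\<^sub>0, \<dots>, y\<^sub>k\<^sub>-\<^sub>1, w\<^sub>I\<^sub>k, z\<^sub>k\<^sub>+\<^sub>1, \<dots>, z\<^sub>d\<close>.\<close>

definition factors :: "nat \<Rightarrow> (nat \<Rightarrow> 'a set) \<Rightarrow> nat \<Rightarrow> 'a list" where
  "factors d I k =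
     map (y_factor I) [0..<k] @ [longest (I k)] @ map (z_factor I) [Suc k..<Suc d]"

definition a_elt :: "nat \<Rightarrow> (nat \<Rightarrow> 'a set) \<Rightarrow> nat \<Rightarrow> 'a" where
  "a_elt d I k = foldr star (factors d I k) \<one>"

definition lengths_add :: "nat \<Rightarrow> (nat \<Rightarrow> 'a set) \<Rightarrow> nat \<Rightarrow> bool" where
  "lengths_add d I k \<longleftrightarrow>
     a_elt d I k = foldr (\<otimes>) (factors d I k) \<one> \<and>
     len (a_elt d I k) = sum_list (map len (factors d I k))"

end

end

theory Submission
  imports Defs
begin

text \<open>
  Write \<open>\<ell>\<close> for \<open>len\<close>, \<open>p\<^sub>i\<close> for the cosets of the forward path, and \<open>x\<^sub>i\<close>, \<open>M\<^sub>i\<close> for the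
  minimal and the maximal element of \<open>p\<^sub>i\<close>.

  First, \<open>k\<close> does not matter. The products \<open>w\<^bsub>I\<^sub>k\<^esub> * z\<^sub>k\<^sub>+\<^sub>1\<close> and \<open>y\<^sub>k * w\<^bsub>I\<^sub>k\<^sub>+\<^sub>1\<^esub>\<close> agree: both are the longest
  element of the larger one of \<open>I\<^sub>k\<close>, \<open>I\<^sub>k\<^sub>+\<^sub>1\<close>, and the lengths of the two factors add up to its
  length (\<open>shift_factor\<close>). Hence \<open>a\<^sub>k\<close> and the total length of its factors are the same for all
  \<open>k\<close>. Since \<open>\<ell> (x * y) \<le> \<ell> x + \<ell> y\<close>, with equality only if \<open>x * y = x y\<close>, the lengths add
  in \<open>a\<^sub>k\<close> if and only if \<open>\<ell> a\<^sub>k\<close> equals this total length (\<open>lengths_add_iff\<close>).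

  For \<open>k = 0\<close> the partial products \<open>w\<^bsub>I\<^sub>0\<^esub> * z\<^sub>1 * \<dots> * z\<^sub>i\<close> are the elements \<open>M\<^sub>i\<close>
  (\<open>max_elt_forward_path_Suc\<close>), so the lengths add if and only if
  \<open>\<ell> M\<^sub>i\<^sub>+\<^sub>1 = \<ell> M\<^sub>i + \<ell> z\<^sub>i\<^sub>+\<^sub>1\<close> for every \<open>i\<close>. If \<open>I\<^sub>i\<^sub>+\<^sub>1\<close> is smaller than \<open>I\<^sub>i\<close>, then
  \<open>M\<^sub>i\<^sub>+\<^sub>1 = M\<^sub>i\<close> and \<open>z\<^sub>i\<^sub>+\<^sub>1 = 1\<close>. If it is larger, one compares the lengths
  \<open>\<ell> M\<^sub>i = \<ell> w\<^bsub>I\<^sub>0\<^esub> - \<ell> w\<^bsub>K\<^sub>i\<^esub> + \<ell> x\<^sub>i + \<ell> w\<^bsub>I\<^sub>i\<^esub>\<close> (\<open>bimaximal_formula\<close>) and gets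
  \<open>\<ell> M\<^sub>i + \<ell> z\<^sub>i\<^sub>+\<^sub>1 - \<ell> M\<^sub>i\<^sub>+\<^sub>1 = (\<ell> x\<^sub>i - \<ell> x\<^sub>i\<^sub>+\<^sub>1) + (\<ell> w\<^bsub>K\<^sub>i\<^sub>+\<^sub>1\<^esub> - \<ell> w\<^bsub>K\<^sub>i\<^esub>)\<close>.
  Both brackets are nonnegative: \<open>x\<^sub>i\<close> is \<open>x\<^sub>i\<^sub>+\<^sub>1\<close> times an element of \<open>W\<^bsub>I\<^sub>i\<^sub>+\<^sub>1\<^esub>\<close> with lengths
  adding, and therefore \<open>K\<^sub>i \<subseteq> K\<^sub>i\<^sub>+\<^sub>1\<close> (\<open>redundancy_mono\<close>). So the lengths add at this
  step exactly if both brackets vanish, that is if \<open>x\<^sub>i = x\<^sub>i\<^sub>+\<^sub>1\<close> and \<open>K\<^sub>i = K\<^sub>i\<^sub>+\<^sub>1\<close>, which is the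
  condition in the definition of a reduced expression (\<open>enlarge_step\<close>).

  The Coxeter theory behind this rests on the exchange condition, which is derived from the
  presentation by counting, modulo 2, how often a reflection occurs along a word
  (\<open>flips_word_prod\<close>). It yields minimal coset representatives, longest elements, and the normal
  form \<open>v x b\<close> with additive lengths in a double coset with minimal element \<open>x\<close>
  (\<open>biminimal_add\<close>). The \<open>*\<close>-product is constructed from the operators that multiply by a simple
  reflection on the right if this increases the length; they commute with the operators on the left.
\<close>

context coxeter_system
begin

section \<open>Words and the reflections along a word\<close>

abbreviation word_prod :: "'a list \<Rightarrow> 'a" where
  "word_prod u \<equiv> foldr (\<otimes>) u \<one>"

text \<open>\<open>foldr_append\<close> would move the second word into the start value of the fold and so hide
  the product of two group elements.\<close>
declare foldr_append [simp del]

lemma S_carrier [simp, intro]: "s \<in> S \<Longrightarrow> s \<in> carrier W"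
  using S_closed by blast

lemma word_prod_closed [simp, intro]: "set u \<subseteq> carrier W \<Longrightarrow> word_prod u \<in> carrier W"
  by (induction u) auto

lemma word_prod_S_closed [simp, intro]: "set u \<subseteq> S \<Longrightarrow> word_prod u \<in> carrier W"
  using S_closed by blast

lemma word_prod_append:
  "\<lbrakk>set u \<subseteq> carrier W; set v \<subseteq> carrier W\<rbrakk> \<Longrightarrow> word_prod (u @ v) = word_prod u \<otimes> word_prod v"
  by (induction u) (auto simp: m_assoc)

lemma cancel_inv_left [simp]:
  "\<lbrakk>x \<in> carrier W; y \<in> carrier W\<rbrakk> \<Longrightarrow> inv x \<otimes> (x \<otimes> y) = y"
  "\<lbrakk>x \<in> carrier W; y \<in> carrier W\<rbrakk> \<Longrightarrow> x \<otimes> (inv x \<otimes> y) = y"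
  by (simp_all flip: m_assoc)

lemma cancel_inv_right [simp]:
  "\<lbrakk>x \<in> carrier W; y \<in> carrier W\<rbrakk> \<Longrightarrow> y \<otimes> x \<otimes> inv x = y"
  "\<lbrakk>x \<in> carrier W; y \<in> carrier W\<rbrakk> \<Longrightarrow> y \<otimes> inv x \<otimes> x = y"
  by (simp_all add: m_assoc)

lemma S_square [simp]:
  assumes "s \<in> S"
  shows "s \<otimes> s = \<one>"
proof -
  obtain m where m: "coxeter_matrix S m"
    "\<And>u v. u \<in> lists S \<Longrightarrow> v \<in> lists S \<Longrightarrow> word_prod u = word_prod v \<longleftrightarrow> coxeter_cong S m u v"
    using S_presentation by blast
  have "m s s = enat 1"
    using m(1) assms by (simp add: coxeter_matrix_def one_enat_def)
  then have "coxeter_cong S m ([] @ concat (replicate 1 [s, s]) @ []) ([] @ [])"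
    using assms by (intro coxeter_cong.relation) auto
  then have "word_prod [s, s] = word_prod []"
    using m(2)[of "[s, s]" "[]"] assms by simp
  then show ?thesis
    using assms by simp
qed

lemma S_inv [simp]: "s \<in> S \<Longrightarrow> inv s = s"
  by (intro inv_equality) auto

lemma S_cancel_left [simp]: "\<lbrakk>s \<in> S; x \<in> carrier W\<rbrakk> \<Longrightarrow> s \<otimes> (s \<otimes> x) = x"
  by (simp flip: m_assoc)

lemma S_cancel_right [simp]: "\<lbrakk>s \<in> S; x \<in> carrier W\<rbrakk> \<Longrightarrow> x \<otimes> s \<otimes> s = x"
  by (simp add: m_assoc)

lemma word_prod_rev: "set u \<subseteq> S \<Longrightarrow> word_prod (rev u) = inv (word_prod u)"
proof (induction u)
  case (Cons s u)
  then have "set (rev u) \<subseteq> carrier W" "set [s] \<subseteq> carrier W"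
    by auto
  with Cons show ?case
    by (simp add: word_prod_append inv_mult_group)
qed simp

lemma conj_eq_iff:
  assumes "c \<in> carrier W" "x \<in> carrier W" "z \<in> carrier W"
  shows "inv c \<otimes> x \<otimes> c = z \<longleftrightarrow> x = c \<otimes> z \<otimes> inv c"
proof
  assume "inv c \<otimes> x \<otimes> c = z"
  then have "c \<otimes> z \<otimes> inv c = c \<otimes> (inv c \<otimes> x \<otimes> c) \<otimes> inv c" by simp
  then show "x = c \<otimes> z \<otimes> inv c"
    using assms by (simp add: m_assoc)
next
  assume x: "x = c \<otimes> z \<otimes> inv c"
  show "inv c \<otimes> x \<otimes> c = z"
    unfolding x using assms by (simp add: m_assoc)
qed

text \<open>For \<open>u = s\<^sub>1 \<dots> s\<^sub>n\<close> this is the parity of the number of \<open>i\<close> with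
  \<open>x = s\<^sub>1 \<dots> s\<^sub>i\<^sub>-\<^sub>1 s\<^sub>i s\<^sub>i\<^sub>-\<^sub>1 \<dots> s\<^sub>1\<close>, that is whether \<open>u\<close>, as a gallery, crosses the wall of
  \<open>x\<close> an odd number of times.\<close>
primrec flips :: "'a list \<Rightarrow> 'a \<Rightarrow> bool" where
  "flips [] x = False"
| "flips (s # u) x = ((x = s) \<noteq> flips u (s \<otimes> x \<otimes> s))"

lemma flips_append:
  "\<lbrakk>set u \<subseteq> S; set v \<subseteq> S; x \<in> carrier W\<rbrakk> \<Longrightarrow>
    flips (u @ v) x = (flips u x \<noteq> flips v (inv (word_prod u) \<otimes> x \<otimes> word_prod u))"
proof (induction u arbitrary: x)
  case (Cons s u)
  then have [simp]: "s \<in> S" "word_prod u \<in> carrier W"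
    by auto
  from Cons show ?case
    by (simp add: inv_mult_group m_assoc) blast
qed simp

lemma word_prod_replicate_pair:
  "\<lbrakk>s \<in> S; t \<in> S\<rbrakk> \<Longrightarrow> word_prod (concat (replicate n [s, t])) = (s \<otimes> t) [^] n"
proof (induction n)
  case (Suc n)
  have "(s \<otimes> t) [^] Suc n = (s \<otimes> t) \<otimes> (s \<otimes> t) [^] n"
    using Suc.prems by (intro nat_pow_Suc2) auto
  with Suc show ?case by (simp add: m_assoc del: nat_pow_Suc)
qed simp

text \<open>Conjugation by \<open>s\<close> inverts the rotation \<open>s t\<close>.\<close>
lemma dihedral_conj_pow:
  assumes "s \<in> S" "t \<in> S"
  shows "(s \<otimes> t) [^] (n::nat) \<otimes> s = s \<otimes> inv ((s \<otimes> t) [^] n)"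
proof (induction n)
  case (Suc n)
  let ?c = "s \<otimes> t"
  have c: "?c \<in> carrier W" "?c [^] n \<in> carrier W" "inv (?c [^] n) \<in> carrier W"
    using assms by auto
  have "?c [^] Suc n \<otimes> s = ?c \<otimes> (?c [^] n \<otimes> s)"
    using assms nat_pow_Suc2[OF c(1), of n] by (simp add: m_assoc del: nat_pow_Suc)
  also have "\<dots> = ?c \<otimes> s \<otimes> inv (?c [^] n)"
    using assms c by (simp add: Suc m_assoc)
  also have "?c \<otimes> s = s \<otimes> inv ?c"
    using assms by (simp add: m_assoc inv_mult_group)
  also have "s \<otimes> inv ?c \<otimes> inv (?c [^] n) = s \<otimes> inv (?c [^] Suc n)"
    using assms c by (simp add: m_assoc inv_mult_group)
  finally show ?case .
qed (use assms in simp)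

text \<open>The walls crossed by the word \<open>(s t)\<^sup>n\<close> are, in order, \<open>c\<^sup>j s\<close> for \<open>j < 2 n\<close>, where
  \<open>c = s t\<close>.\<close>
lemma flips_replicate_pair:
  assumes "s \<in> S" "t \<in> S" "x \<in> carrier W"
  shows "flips (concat (replicate n [s, t])) x = odd (card {j. j < 2 * n \<and> x = (s \<otimes> t) [^] j \<otimes> s})"
    (is "_ = odd (card (?A n))")
proof (induction n)
  case (Suc n)
  let ?c = "s \<otimes> t" and ?u = "concat (replicate n [s, t])"
  let ?C = "?c [^] n"
  have C: "?C \<in> carrier W" "?c \<in> carrier W"
    using assms by auto
  let ?y = "inv ?C \<otimes> x \<otimes> ?C"
  have dbl: "?C \<otimes> g \<otimes> s \<otimes> inv ?C = ?C \<otimes> g \<otimes> ?C \<otimes> s" if "g \<in> carrier W" for g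
    using dihedral_conj_pow[OF assms(1,2), of n] assms(1,2) C that
    by (simp add: m_assoc)
  note conj = conj_eq_iff[OF C(1) assms(3)]
  have 1: "?y = s \<longleftrightarrow> x = ?c [^] (2 * n) \<otimes> s"
    using conj[of s] dbl[of \<one>] assms C by (simp add: nat_pow_mult mult_2)
  have "?C \<otimes> ?c \<otimes> ?C = ?c [^] Suc n \<otimes> ?C"
    by simp
  also have "\<dots> = ?c [^] Suc (2 * n)"
    using nat_pow_mult[OF C(2), of "Suc n" n] by (simp add: mult_2 del: nat_pow_Suc)
  finally have "?C \<otimes> ?c \<otimes> ?C = ?c [^] (Suc (2 * n))" .
  then have cc: "?C \<otimes> (?c \<otimes> s) \<otimes> inv ?C = ?c [^] Suc (2 * n) \<otimes> s"
    using dbl[of ?c] C assms by (simp add: m_assoc[symmetric] del: nat_pow_Suc)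
  have "s \<otimes> ?y \<otimes> s = t \<longleftrightarrow> ?y = ?c \<otimes> s"
    using conj_eq_iff[of s ?y t] assms C by simp
  then have 2: "s \<otimes> ?y \<otimes> s = t \<longleftrightarrow> x = ?c [^] (Suc (2 * n)) \<otimes> s"
    using conj[of "?c \<otimes> s"] cc assms by simp
  have "flips (concat (replicate (Suc n) [s, t])) x = flips (?u @ [s, t]) x"
    by (simp flip: replicate_append_same)
  also have "\<dots> = (flips ?u x \<noteq> flips [s, t] ?y)"
    using assms C
    by (subst flips_append) (auto simp: word_prod_replicate_pair)
  also have "\<dots> = (odd (card (?A n)) \<noteq> ((x = ?c [^] (2 * n) \<otimes> s) \<noteq> (x = ?c [^] (Suc (2 * n)) \<otimes> s)))"
    unfolding Suc.IH by (simp only: flips.simps 1 2) simp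
  also have "\<dots> = odd (card (?A (Suc n)))"
  proof -
    let ?B = "{2 * n} \<inter> {j. x = ?c [^] j \<otimes> s}"
    let ?D = "{Suc (2 * n)} \<inter> {j. x = ?c [^] j \<otimes> s}"
    have A: "?A (Suc n) = ?A n \<union> (?B \<union> ?D)"
      using less_Suc_eq by auto
    have "card (?A n \<union> (?B \<union> ?D)) = card (?A n) + card (?B \<union> ?D)"
      by (rule card_Un_disjoint) auto
    moreover have "card (?B \<union> ?D) = card ?B + card ?D"
      by (rule card_Un_disjoint) auto
    moreover have "card ({k} \<inter> {j. Q j}) = of_bool (Q k)" for k :: nat and Q
      by auto
    moreover have "(odd k \<noteq> (p \<noteq> q)) = odd (k + (of_bool p + of_bool q))" for k :: nat and p q
      by (cases p; cases q) auto
    ultimately show ?thesis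
      unfolding A by (simp only:)
  qed
  finally show ?case .
qed simp

text \<open>If \<open>c\<^sup>n = 1\<close>, then \<open>j\<close> and \<open>j + n\<close> give the same reflection \<open>c\<^sup>j s\<close>, so every wall is
  crossed an even number of times.\<close>
lemma flips_relation:
  assumes "s \<in> S" "t \<in> S" "x \<in> carrier W" "(s \<otimes> t) [^] n = \<one>"
  shows "\<not> flips (concat (replicate n [s, t])) x"
proof -
  let ?A = "{j. j < n \<and> x = (s \<otimes> t) [^] j \<otimes> s}"
  have per: "(s \<otimes> t) [^] (j + n) = (s \<otimes> t) [^] j" for j
    using assms by (simp flip: nat_pow_mult)
  have LR: "{j. j < 2 * n \<and> x = (s \<otimes> t) [^] j \<otimes> s} = ?A \<union> (\<lambda>j. j + n) ` ?A" (is "?L = ?R")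
  proof
    show "?L \<subseteq> ?R"
    proof
      fix j assume j: "j \<in> ?L"
      show "j \<in> ?R"
      proof (cases "j < n")
        case False
        then have "j = (j - n) + n" "j - n < n" using j by auto
        then show ?thesis using j per[of "j - n"] by auto
      qed (use j in auto)
    qed
  qed (auto simp: per)
  have "card ?R = card ?A + card ((\<lambda>j. j + n) ` ?A)"
    by (rule card_Un_disjoint) auto
  also have "\<dots> = 2 * card ?A"
    by (simp add: card_image)
  finally show ?thesis
    unfolding flips_replicate_pair[OF assms(1-3)] LR by simp
qed

lemma flips_cong:
  assumes "coxeter_cong S m u v"
    and pres: "\<And>u v. u \<in> lists S \<Longrightarrow> v \<in> lists S \<Longrightarrow> word_prod u = word_prod v \<longleftrightarrow> coxeter_cong S m u v"
    and "x \<in> carrier W"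
  shows "flips u x = flips v x"
  using assms(1)
proof induction
  case (relation u v s t n)
  let ?w = "concat (replicate n [s, t])"
  have w: "set ?w \<subseteq> S" using relation by auto
  have "coxeter_cong S m ([] @ ?w @ []) ([] @ [])"
    using relation by (intro coxeter_cong.relation) auto
  then have "word_prod ?w = word_prod []"
    using pres[of ?w "[]"] w by (simp add: in_lists_conv_set subset_iff)
  then have 1: "(s \<otimes> t) [^] n = \<one>"
    using relation by (simp add: word_prod_replicate_pair)
  have [simp]: "word_prod u \<in> carrier W" using relation by auto
  show ?case
    using relation w \<open>x \<in> carrier W\<close> 1
    by (simp add: flips_append flips_relation in_lists_conv_set subset_iff word_prod_replicate_pair)
qed auto

text \<open>The parity is constant on words with the same product: by \<open>flips_append\<close> it suffices that
  the relators cross every wall evenly. This is where the presentation enters.\<close>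
lemma flips_word_prod:
  assumes "set u \<subseteq> S" "set v \<subseteq> S" "word_prod u = word_prod v" "x \<in> carrier W"
  shows "flips u x = flips v x"
proof -
  obtain m where m: 
    "\<And>u v. u \<in> lists S \<Longrightarrow> v \<in> lists S \<Longrightarrow> word_prod u = word_prod v \<longleftrightarrow> coxeter_cong S m u v"
    using S_presentation by blast
  have "coxeter_cong S m u v"
    using m assms by (auto simp: in_lists_conv_set)
  then show ?thesis
    using flips_cong m assms by blast
qed

text \<open>An odd number of crossings is at least one, and multiplication by the reflection of a crossed
  wall deletes the letter at which the crossing happens.\<close>
lemma flips_delete:
  "\<lbrakk>set u \<subseteq> S; x \<in> carrier W; flips u x\<rbrakk> \<Longrightarrow>
    \<exists>u1 r u2. u = u1 @ r # u2 \<and> x \<otimes> word_prod u = word_prod (u1 @ u2)"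
proof (induction u arbitrary: x)
  case (Cons s u)
  then have [simp]: "s \<in> S" and u: "set u \<subseteq> S" and [simp]: "word_prod u \<in> carrier W"
    by auto
  show ?case
  proof (cases "x = s")
    case True
    then have "s # u = [] @ s # u" "x \<otimes> word_prod (s # u) = word_prod ([] @ u)"
      by auto
    then show ?thesis by blast
  next
    case False
    then have "flips u (s \<otimes> x \<otimes> s)"
      using Cons.prems by simp
    then obtain u1 r u2 where *: "u = u1 @ r # u2" "s \<otimes> x \<otimes> s \<otimes> word_prod u = word_prod (u1 @ u2)"
      using Cons.IH[of "s \<otimes> x \<otimes> s"] Cons.prems u by auto
    have "x \<otimes> word_prod (s # u) = s \<otimes> (s \<otimes> x \<otimes> s \<otimes> word_prod u)"
      using Cons.prems by (simp add: m_assoc)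
    also have "\<dots> = word_prod ((s # u1) @ u2)"
      by (simp add: *(2))
    finally show ?thesis
      using *(1) by (metis append_Cons)
  qed
qed simp

section \<open>Length and exchange\<close>

lemma generate_words:
  assumes "J \<subseteq> S"
  shows "generate W J = {word_prod u | u. set u \<subseteq> J}"
proof
  show "generate W J \<subseteq> {word_prod u | u. set u \<subseteq> J}"
  proof
    fix x assume "x \<in> generate W J"
    then show "x \<in> {word_prod u | u. set u \<subseteq> J}"
    proof induction
      case one
      show ?case by (auto intro!: exI[of _ "[]"])
    next
      case (incl h)
      then show ?case using assms by (auto intro!: exI[of _ "[h]"])
    next
      case (inv h)
      then show ?case using assms by (auto intro!: exI[of _ "[h]"])
    next
      case (eng g h)
      then obtain u v where "g = word_prod u" "set u \<subseteq> J" "h = word_prod v" "set v \<subseteq> J"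
        by blast
      moreover from this have "set u \<subseteq> carrier W" "set v \<subseteq> carrier W"
        using assms S_closed by auto
      ultimately show ?case
        by (auto simp: word_prod_append intro!: exI[of _ "u @ v"])
    qed
  qed
next
  have "word_prod u \<in> generate W J" if "set u \<subseteq> J" for u
    using that by (induction u) (auto intro: generate.intros)
  then show "{word_prod u | u. set u \<subseteq> J} \<subseteq> generate W J"
    by blast
qed

lemma len_word_prod_le: "set u \<subseteq> S \<Longrightarrow> len (word_prod u) \<le> length u"
  unfolding len_def by (rule Least_le) (auto simp: in_lists_conv_set)

lemma reduced_word:
  assumes "w \<in> carrier W"
  obtains u where "set u \<subseteq> S" "length u = len w" "word_prod u = w"
proof -
  obtain v where "set v \<subseteq> S" "word_prod v = w"
    using assms generate_words[of S] S_generates by auto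
  then have "\<exists>n. \<exists>u\<in>lists S. length u = n \<and> word_prod u = w"
    by (auto simp: in_lists_conv_set)
  from LeastI_ex[OF this] show ?thesis
    using that unfolding len_def[symmetric] by (auto simp: in_lists_conv_set)
qed

lemma len_one [simp]: "len \<one> = 0"
  using len_word_prod_le[of "[]"] by simp

lemma len_eq_0_iff: "x \<in> carrier W \<Longrightarrow> len x = 0 \<longleftrightarrow> x = \<one>"
  by (metis foldr_Nil id_apply len_one length_0_conv reduced_word)

lemma len_mult_le:
  assumes "x \<in> carrier W" "y \<in> carrier W"
  shows "len (x \<otimes> y) \<le> len x + len y"
proof -
  obtain u v where "set u \<subseteq> S" "length u = len x" "word_prod u = x"
    "set v \<subseteq> S" "length v = len y" "word_prod v = y"
    using assms reduced_word by metis
  then show ?thesis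
    using len_word_prod_le[of "u @ v"] S_closed by (simp add: word_prod_append)
qed

lemma len_S_le: "s \<in> S \<Longrightarrow> len s \<le> 1"
  using len_word_prod_le[of "[s]"] by simp

lemma len_inv [simp]:
  assumes "x \<in> carrier W"
  shows "len (inv x) = len x"
proof -
  have *: "len (inv x) \<le> len x" if x: "x \<in> carrier W" for x
  proof -
    obtain u where "set u \<subseteq> S" "length u = len x" "word_prod u = x"
      using reduced_word[OF x] .
    then show ?thesis
      using len_word_prod_le[of "rev u"] by (simp add: word_prod_rev)
  qed
  show ?thesis
    using *[OF assms] *[of "inv x"] assms by simp
qed

text \<open>If \<open>u\<close> crosses the wall of \<open>s\<close> an odd number of times, a letter can be deleted. Otherwise
  the words for \<open>s w\<close>, where \<open>w\<close> is the product of \<open>u\<close>, cross it an odd number of times, and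
  deleting a letter in a reduced one of them shows that \<open>w\<close> is shorter than \<open>s w\<close>.\<close>
lemma exchange_left:
  assumes s: "s \<in> S" and u: "set u \<subseteq> S" and "\<not> len (word_prod u) < len (s \<otimes> word_prod u)"
  shows "\<exists>u1 r u2. u = u1 @ r # u2 \<and> s \<otimes> word_prod u = word_prod (u1 @ u2)"
proof (cases "flips u s")
  case True
  then show ?thesis using flips_delete s u by blast
next
  case False
  let ?w = "word_prod u"
  have w: "?w \<in> carrier W" using u by auto
  then obtain v where v: "set v \<subseteq> S" "length v = len (s \<otimes> ?w)" "word_prod v = s \<otimes> ?w"
    using reduced_word[of "s \<otimes> ?w"] s by auto
  have "flips v s = flips (s # u) s"
    using s u v by (intro flips_word_prod) auto
  then have "flips v s"
    using False s by simp
  then obtain v1 r v2 where d: "v = v1 @ r # v2" "s \<otimes> word_prod v = word_prod (v1 @ v2)"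
    using flips_delete v(1) s by blast
  then have "len ?w < length v"
    using v s w len_word_prod_le[of "v1 @ v2"] by auto
  then show ?thesis
    using v assms by simp
qed

lemma exchange_right:
  assumes s: "s \<in> S" and u: "set u \<subseteq> S" and "\<not> len (word_prod u) < len (word_prod u \<otimes> s)"
  shows "\<exists>u1 r u2. u = u1 @ r # u2 \<and> word_prod u \<otimes> s = word_prod (u1 @ u2)"
proof -
  have w: "word_prod u \<in> carrier W" using u by auto
  have inv: "inv (word_prod u \<otimes> s) = s \<otimes> word_prod (rev u)"
    using s u w by (simp add: inv_mult_group word_prod_rev)
  have "len (s \<otimes> word_prod (rev u)) = len (word_prod u \<otimes> s)"
    unfolding inv[symmetric] using s w by simp
  then have "\<not> len (word_prod (rev u)) < len (s \<otimes> word_prod (rev u))"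
    using assms w by (simp add: word_prod_rev)
  then obtain v1 r v2 where v: "rev u = v1 @ r # v2" "s \<otimes> word_prod (rev u) = word_prod (v1 @ v2)"
    using exchange_left[of s "rev u"] s u by auto
  have u': "u = rev v2 @ r # rev v1"
    using arg_cong[OF v(1), of rev] by simp
  have "word_prod u \<otimes> s = inv (s \<otimes> word_prod (rev u))"
    using w s by (simp flip: inv)
  also have "\<dots> = word_prod (rev v2 @ rev v1)"
    unfolding v(2) using u u' by (subst word_prod_rev[symmetric]) auto
  finally show ?thesis using u' by blast
qed

lemma len_left_cases:
  assumes "s \<in> S" "w \<in> carrier W"
  obtains "len (s \<otimes> w) = Suc (len w)" | "len w = Suc (len (s \<otimes> w))"
proof -
  have 1: "len (s \<otimes> w) \<le> Suc (len w)"
    using len_mult_le[of s w] len_S_le[of s] assms by auto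
  have 2: "len w \<le> Suc (len (s \<otimes> w))"
    using len_mult_le[of s "s \<otimes> w"] len_S_le[of s] assms by auto
  have "len (s \<otimes> w) < len w" if not_less: "\<not> len w < len (s \<otimes> w)"
  proof -
    obtain u where u: "set u \<subseteq> S" "length u = len w" "word_prod u = w"
      using reduced_word[OF assms(2)] .
    then obtain u1 r u2 where "u = u1 @ r # u2" "s \<otimes> w = word_prod (u1 @ u2)"
      using exchange_left[of s u] assms not_less by auto
    then show ?thesis
      using len_word_prod_le[of "u1 @ u2"] u by auto
  qed
  then show ?thesis using 1 2 that by linarith
qed

lemma len_right_cases:
  assumes "s \<in> S" "w \<in> carrier W"
  obtains "len (w \<otimes> s) = Suc (len w)" | "len w = Suc (len (w \<otimes> s))"
proof -
  have "len (w \<otimes> s) = len (s \<otimes> inv w)"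
    using len_inv[of "w \<otimes> s"] assms by (simp add: inv_mult_group)
  then show ?thesis
    using len_left_cases[of s "inv w"] assms that by auto
qed

lemma len_S [simp]: "s \<in> S \<Longrightarrow> len s = 1"
  using len_left_cases[of s \<one>] by auto

lemma generate_closed [intro]: "\<lbrakk>J \<subseteq> S; x \<in> generate W J\<rbrakk> \<Longrightarrow> x \<in> carrier W"
  using S_closed generate_incl[of J] by blast

lemma generate_inv: "\<lbrakk>J \<subseteq> S; x \<in> generate W J\<rbrakk> \<Longrightarrow> inv x \<in> generate W J"
  using S_closed generate_m_inv_closed[of J] by blast

text \<open>Exchange reduces a word by deleting letters, so no new letters appear; this gives reduced words
  inside parabolic subgroups.\<close>
lemma reduced_subword:
  assumes "set u \<subseteq> S"
  shows "\<exists>v. set v \<subseteq> set u \<and> word_prod v = word_prod u \<and> length v = len (word_prod u)"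
  using assms
proof (induction u)
  case (Cons s u)
  then obtain v where v: "set v \<subseteq> set u" "word_prod v = word_prod u" "length v = len (word_prod u)"
    by auto
  have s: "s \<in> S" "word_prod u \<in> carrier W" "set v \<subseteq> S"
    using Cons v by auto
  show ?case
    using s(1,2)
  proof (cases rule: len_left_cases)
    case 1
    then show ?thesis
      using v by (intro exI[of _ "s # v"]) auto
  next
    case 2
    then obtain v1 r v2 where d: "v = v1 @ r # v2" "s \<otimes> word_prod v = word_prod (v1 @ v2)"
      using exchange_left[of s v] s v by auto
    then show ?thesis
      using 2 v by (intro exI[of _ "v1 @ v2"]) auto
  qed
qed auto

lemma reduced_word_generate:
  assumes "J \<subseteq> S" "x \<in> generate W J"
  obtains u where "set u \<subseteq> J" "length u = len x" "word_prod u = x"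
  using assms reduced_subword generate_words by (smt (verit) mem_Collect_eq subset_trans)

lemma generate_len_1:
  assumes "J \<subseteq> S" "r \<in> generate W J" "len r = 1"
  shows "r \<in> J"
proof -
  obtain u where "set u \<subseteq> J" "length u = 1" "word_prod u = r"
    using reduced_word_generate[OF assms(1,2)] assms(3) by metis
  then show ?thesis
    using assms by (auto simp: length_Suc_conv)
qed

lemma left_descent_exists:
  assumes "J \<subseteq> S" "x \<in> generate W J" "x \<noteq> \<one>"
  obtains s where "s \<in> J" "s \<otimes> x \<in> generate W J" "len x = Suc (len (s \<otimes> x))"
proof -
  obtain u where u: "set u \<subseteq> J" "length u = len x" "word_prod u = x"
    using reduced_word_generate[OF assms(1,2)] .
  then obtain s v where sv: "u = s # v"
    using assms(3) by (cases u) auto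
  have v: "set v \<subseteq> S" and s: "s \<in> S" using u sv assms by auto
  have x: "s \<otimes> x = word_prod v" using u sv s v by auto
  have "len (s \<otimes> x) < len x"
    using len_word_prod_le[OF v] u sv x by simp
  then have "len x = Suc (len (s \<otimes> x))"
    using len_left_cases[of s x] s assms by (metis generate_closed not_less_iff_gr_or_eq lessI)
  moreover have "s \<otimes> x \<in> generate W J"
    using x u sv generate_words[OF assms(1)] by auto
  ultimately show ?thesis using that u sv by auto
qed

text \<open>Apply exchange to a reduced word of \<open>a\<close> followed by one of \<open>b\<close>. The deleted letter cannot
  be a letter of \<open>b\<close>, as then \<open>b s\<close> would be shorter than \<open>b\<close>.\<close>
lemma exchange_product_right:
  assumes "J \<subseteq> S" "a \<in> generate W J" "b \<in> carrier W" "s \<in> S"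
    and "len b < len (b \<otimes> s)" "\<not> len (a \<otimes> b) < len (a \<otimes> b \<otimes> s)"
  shows "\<exists>a'\<in>generate W J. len a' < len a \<and> a \<otimes> b \<otimes> s = a' \<otimes> b"
proof -
  obtain u where u: "set u \<subseteq> J" "length u = len a" "word_prod u = a"
    using reduced_word_generate[OF assms(1,2)] .
  obtain v where v: "set v \<subseteq> S" "length v = len b" "word_prod v = b"
    using reduced_word[OF assms(3)] .
  have a: "a \<in> carrier W" and uS: "set u \<subseteq> S" using assms u by auto
  have c: "set u \<subseteq> carrier W" "set v \<subseteq> carrier W" using S_closed uS v by auto
  then have ab: "word_prod (u @ v) = a \<otimes> b"
    using u v by (simp add: word_prod_append)
  then obtain u1 r u2 where d: "u @ v = u1 @ r # u2" "a \<otimes> b \<otimes> s = word_prod (u1 @ u2)"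
    using exchange_right[of s "u @ v"] assms uS v by auto
  then consider us where "u = u1 @ r # us" "u2 = us @ v" | us where "u1 = u @ us" "v = us @ r # u2"
    unfolding append_eq_append_conv2 append_eq_Cons_conv by fastforce
  then show ?thesis
  proof cases
    case 1
    then have "set (u1 @ us) \<subseteq> J" "length (u1 @ us) < len a" "set (u1 @ us) \<subseteq> S"
      using u uS by auto
    moreover from this have "a \<otimes> b \<otimes> s = word_prod (u1 @ us) \<otimes> b"
      using d 1 c v word_prod_append[of "u1 @ us" v] by auto
    moreover have "word_prod (u1 @ us) \<in> generate W J"
      using \<open>set (u1 @ us) \<subseteq> J\<close> generate_words[OF assms(1)] by blast
    ultimately show ?thesis
      using len_word_prod_le[of "u1 @ us"]
      by (intro bexI[of _ "word_prod (u1 @ us)"]) auto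
  next
    case 2
    then have "a \<otimes> b \<otimes> s = a \<otimes> word_prod (us @ u2)"
      using d u c word_prod_append[of u "us @ u2"] by auto
    then have "b \<otimes> s = word_prod (us @ u2)"
      using a assms 2 v by (simp add: m_assoc)
    then show ?thesis
      using len_word_prod_le[of "us @ u2"] 2 v assms(5) by auto
  qed
qed

lemma exchange_product_left:
  assumes "J \<subseteq> S" "a \<in> carrier W" "b \<in> generate W J" "s \<in> S"
    and "len a < len (s \<otimes> a)" "\<not> len (a \<otimes> b) < len (s \<otimes> (a \<otimes> b))"
  shows "\<exists>b'\<in>generate W J. len b' < len b \<and> s \<otimes> (a \<otimes> b) = a \<otimes> b'"
proof -
  have b: "b \<in> carrier W" using assms by auto
  have i1: "inv b \<otimes> inv a = inv (a \<otimes> b)" "inv b \<otimes> inv a \<otimes> s = inv (s \<otimes> (a \<otimes> b))"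
     "inv a \<otimes> s = inv (s \<otimes> a)"
    using assms b by (simp_all add: inv_mult_group)
  have "\<exists>b'\<in>generate W J. len b' < len (inv b) \<and> inv b \<otimes> inv a \<otimes> s = b' \<otimes> inv a"
  proof (rule exchange_product_right[OF assms(1)])
    show "len (inv a) < len (inv a \<otimes> s)"
      unfolding i1 using assms by simp
    show "\<not> len (inv b \<otimes> inv a) < len (inv b \<otimes> inv a \<otimes> s)"
      unfolding i1(2) unfolding i1(1) using assms b by simp
  qed (use assms generate_inv in auto)
  then obtain b' where b': "b' \<in> generate W J" "len b' < len b" "inv (s \<otimes> (a \<otimes> b)) = b' \<otimes> inv a"
    using b i1 by auto
  then have "b' \<in> carrier W" using assms by auto
  moreover from this have "s \<otimes> (a \<otimes> b) = inv (b' \<otimes> inv a)"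
    using assms b by (simp flip: b'(3))
  ultimately have "s \<otimes> (a \<otimes> b) = a \<otimes> inv b'"
    using assms by (simp add: inv_mult_group)
  with b' \<open>b' \<in> carrier W\<close> show ?thesis
    using assms generate_inv[of J b'] by (intro bexI[of _ "inv b'"]) auto
qed

section \<open>Cosets of parabolic subgroups\<close>

definition left_minimal :: "'a set \<Rightarrow> 'a \<Rightarrow> bool" where
  "left_minimal J x \<longleftrightarrow> (\<forall>s\<in>J. len x < len (s \<otimes> x))"

definition right_minimal :: "'a set \<Rightarrow> 'a \<Rightarrow> bool" where
  "right_minimal I x \<longleftrightarrow> (\<forall>s\<in>I. len x < len (x \<otimes> s))"

lemma generate_S [simp]: "generate W S = carrier W"
  by (rule S_generates)

lemma generate_mult: "\<lbrakk>x \<in> generate W J; y \<in> generate W J\<rbrakk> \<Longrightarrow> x \<otimes> y \<in> generate W J"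
  by (rule generate.eng)

lemma coset_minimum_add:
  assumes "J \<subseteq> S" "m \<in> carrier W" "\<And>a. a \<in> generate W J \<Longrightarrow> len m \<le> len (a \<otimes> m)"
    and "a \<in> generate W J"
  shows "len (a \<otimes> m) = len a + len m"
  using assms(4)
proof (induction "len a" arbitrary: a)
  case 0
  then have "a = \<one>" using len_eq_0_iff assms(1) by auto
  then show ?case using assms by simp
next
  case (Suc n)
  then have "a \<noteq> \<one>" by auto
  then obtain s where s: "s \<in> J" "s \<otimes> a \<in> generate W J" "len a = Suc (len (s \<otimes> a))"
    using left_descent_exists assms(1) Suc by metis
  define a' where "a' = s \<otimes> a"
  have S: "s \<in> S" using s assms by auto
  have a: "a \<in> carrier W" "a' \<in> carrier W"
    using Suc.prems s assms(1) a'_def by auto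
  have a': "a' \<in> generate W J" "len a = Suc (len a')" "a = s \<otimes> a'"
    using s a S by (auto simp: a'_def)
  have IH: "len (a' \<otimes> m) = len a' + len m"
    using Suc a' by simp
  have am: "a \<otimes> m = s \<otimes> (a' \<otimes> m)"
    using a' a S assms by (simp add: m_assoc)
  have "len (a' \<otimes> m) < len (s \<otimes> (a' \<otimes> m))"
  proof (rule ccontr)
    \<comment> \<open>Exchange would delete a letter of \<open>m\<close> and give a shorter element of the same coset.\<close>
    assume "\<not> len (a' \<otimes> m) < len (s \<otimes> (a' \<otimes> m))"
    then obtain m' where m': "m' \<in> carrier W" "len m' < len m" "s \<otimes> (a' \<otimes> m) = a' \<otimes> m'"
      using exchange_product_left[of S a' m s] a a' S assms by auto
    then have "m' = inv a' \<otimes> (s \<otimes> (a' \<otimes> m))"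
      using a by simp
    also have "\<dots> = (inv a' \<otimes> s \<otimes> a') \<otimes> m"
      using a S assms by (simp add: m_assoc)
    finally have "len m \<le> len m'"
      using assms a' generate_inv generate_mult s(1) generate.incl by metis
    with m' show False by simp
  qed
  then show ?case
    using len_left_cases[of s "a' \<otimes> m"] S a assms IH a' am by (metis add_Suc m_closed not_less_iff_gr_or_eq lessI)
qed

lemma coset_minimum_exists:
  assumes "J \<subseteq> S" "w \<in> carrier W"
  obtains a m where "a \<in> generate W J" "m \<in> carrier W" "w = a \<otimes> m"
    "\<And>c. c \<in> generate W J \<Longrightarrow> len m \<le> len (c \<otimes> m)"
proof -
  obtain a where a: "a \<in> generate W J" "\<forall>c. c \<in> generate W J \<longrightarrow> len (a \<otimes> w) \<le> len (c \<otimes> w)"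
    using ex_has_least_nat[of "\<lambda>a. a \<in> generate W J" \<one> "\<lambda>a. len (a \<otimes> w)"] generate.one by auto
  have ac: "a \<in> carrier W" using a assms by auto
  show ?thesis
  proof
    show "inv a \<in> generate W J" "a \<otimes> w \<in> carrier W" "w = inv a \<otimes> (a \<otimes> w)"
      using a ac assms generate_inv by auto
    fix c assume "c \<in> generate W J"
    then show "len (a \<otimes> w) \<le> len (c \<otimes> (a \<otimes> w))"
      using a generate_mult[of c J a] assms ac by (metis generate_closed m_assoc)
  qed
qed

text \<open>Local minimality implies global minimality: if \<open>x = b m\<close> with \<open>m\<close> of minimal length in the
  coset, then a left descent of \<open>b\<close> is one of \<open>x\<close>.\<close>
lemma left_minimal_add:
  assumes "J \<subseteq> S" "x \<in> carrier W" "left_minimal J x" "a \<in> generate W J"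
  shows "len (a \<otimes> x) = len a + len x"
proof -
  obtain b m where b: "b \<in> generate W J" "m \<in> carrier W" "x = b \<otimes> m"
    and m: "\<And>c. c \<in> generate W J \<Longrightarrow> len m \<le> len (c \<otimes> m)"
    using coset_minimum_exists assms by metis
  note add = coset_minimum_add[OF assms(1) b(2) m]
  have "b = \<one>"
  proof (rule ccontr)
    assume "b \<noteq> \<one>"
    then obtain s where s: "s \<in> J" "s \<otimes> b \<in> generate W J" "len b = Suc (len (s \<otimes> b))"
      using left_descent_exists b assms by metis
    then have "s \<otimes> x = (s \<otimes> b) \<otimes> m"
      using b assms by (metis S_carrier generate_closed m_assoc subsetD)
    then have "len (s \<otimes> x) < len x"
      using add s b by simp
    then show False using assms(3) s(1) unfolding left_minimal_def by fastforce
  qed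
  then show ?thesis using add assms b by simp
qed

lemma left_minimal_decomposition:
  assumes "J \<subseteq> S" "w \<in> carrier W"
  obtains a m where "a \<in> generate W J" "m \<in> carrier W" "left_minimal J m" "w = a \<otimes> m"
proof -
  obtain a m where a: "a \<in> generate W J" "m \<in> carrier W" "w = a \<otimes> m"
    and m: "\<And>c. c \<in> generate W J \<Longrightarrow> len m \<le> len (c \<otimes> m)"
    using coset_minimum_exists assms by metis
  have "left_minimal J m"
    unfolding left_minimal_def
  proof
    fix s assume "s \<in> J"
    then show "len m < len (s \<otimes> m)"
      using m[of s] generate.incl[of s J] len_left_cases[of s m] a assms by (metis subsetD lessI not_less)
  qed
  then show ?thesis using that a by blast
qed

lemma right_minimal_iff_inv:
  assumes "I \<subseteq> S" "x \<in> carrier W"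
  shows "right_minimal I x \<longleftrightarrow> left_minimal I (inv x)"
proof -
  have "len (x \<otimes> s) = len (s \<otimes> inv x)" if "s \<in> I" for s
  proof -
    have "len (x \<otimes> s) = len (inv (x \<otimes> s))"
      using assms that by (subst len_inv) auto
    also have "inv (x \<otimes> s) = s \<otimes> inv x"
      using assms that by (subst inv_mult_group) auto
    finally show ?thesis .
  qed
  then show ?thesis
    using assms by (auto simp: left_minimal_def right_minimal_def)
qed

lemma right_minimal_add:
  assumes "I \<subseteq> S" "x \<in> carrier W" "right_minimal I x" "b \<in> generate W I"
  shows "len (x \<otimes> b) = len x + len b"
proof -
  have b: "b \<in> carrier W" using assms by auto
  have "len (x \<otimes> b) = len (inv (x \<otimes> b))"
    using assms b by (subst len_inv) auto
  also have "\<dots> = len (inv b \<otimes> inv x)"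
    using assms b by (simp add: inv_mult_group)
  also have "\<dots> = len (inv b) + len (inv x)"
    using assms right_minimal_iff_inv generate_inv by (intro left_minimal_add[of I]) auto
  finally show ?thesis using assms b by simp
qed

lemma right_minimal_decomposition:
  assumes "I \<subseteq> S" "w \<in> carrier W"
  obtains b m where "b \<in> generate W I" "m \<in> carrier W" "right_minimal I m" "w = m \<otimes> b"
proof -
  obtain a m where a: "a \<in> generate W I" "m \<in> carrier W" "left_minimal I m" "inv w = a \<otimes> m"
    using left_minimal_decomposition[of I "inv w"] assms by auto
  have ac: "a \<in> carrier W" using a assms by auto
  have "w = inv (a \<otimes> m)" using a(4) assms by (metis inv_inv)
  also have "\<dots> = inv m \<otimes> inv a"
    using a ac by (simp add: inv_mult_group)
  finally show ?thesis
    using that[of "inv a" "inv m"] right_minimal_iff_inv[of I "inv m"] a assms generate_inv by auto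
qed

section \<open>Longest elements\<close>

text \<open>An element of a parabolic subgroup with all left descents has a reduced word starting with
  any given element \<open>v\<close>. In the induction, \<open>v = s v'\<close> and \<open>w = v' u\<close>; since \<open>s w < w\<close>, exchange
  deletes a letter, and it is one of \<open>u\<close> because \<open>s v'\<close> is longer than \<open>v'\<close>.\<close>
lemma descents_add:
  assumes "J \<subseteq> S" "w \<in> generate W J" "\<And>s. s \<in> J \<Longrightarrow> len (s \<otimes> w) < len w"
    and "v \<in> generate W J"
  shows "len w = len v + len (inv v \<otimes> w)"
  using assms(4)
proof (induction "len v" arbitrary: v)
  case 0
  then have "v = \<one>" using len_eq_0_iff assms(1) by auto
  then show ?case using generate_closed[OF assms(1,2)] by auto
next
  case (Suc n)
  then have "v \<noteq> \<one>" by auto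
  then obtain s where s: "s \<in> J" "s \<otimes> v \<in> generate W J" "len v = Suc (len (s \<otimes> v))"
    using left_descent_exists assms(1) Suc by metis
  define v' where "v' = s \<otimes> v"
  define u where "u = inv v' \<otimes> w"
  have S: "s \<in> S" using s assms by auto
  have c: "v \<in> carrier W" "v' \<in> carrier W" "w \<in> carrier W" "u \<in> carrier W"
    using Suc.prems s assms(1,2) v'_def u_def by auto
  have v': "v' \<in> generate W J" "len v = Suc (len v')" "v = s \<otimes> v'"
    using s c S by (auto simp: v'_def)
  have w: "w = v' \<otimes> u" and u: "u \<in> generate W J"
    using c assms v' generate_inv generate_mult by (auto simp: u_def)
  have IH: "len w = len v' + len u"
    using Suc v' u_def by simp
  have "len (s \<otimes> (v' \<otimes> u)) < len (v' \<otimes> u)"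
    using assms(3)[OF s(1)] w by simp
  then obtain u' where u': "u' \<in> generate W J" "len u' < len u" "s \<otimes> (v' \<otimes> u) = v' \<otimes> u'"
    using exchange_product_left[of J v' u s] assms c u S v' by auto
  have u'c: "u' \<in> carrier W" using u' assms by auto
  have "w = s \<otimes> (v' \<otimes> u')"
    using u'(3) w S c by (metis S_cancel_left)
  then have wvu: "w = v \<otimes> u'"
    using v' S c u'c by (simp add: m_assoc)
  then have "inv v \<otimes> w = u'"
    using c u'c by simp
  moreover have "len w \<le> len v + len u'"
    using wvu len_mult_le c u'c by simp
  ultimately show ?case
    using IH v' u' by simp
qed

lemma finitary_subset: "\<lbrakk>finitary J; K \<subseteq> J\<rbrakk> \<Longrightarrow> finitary K"
  unfolding finitary_def using mono_generate[of K J] finite_subset by blast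

lemma longest_unique:
  assumes "finitary J" "w \<in> generate W J" "\<And>s. s \<in> J \<Longrightarrow> len (s \<otimes> w) < len w"
  shows "w = longest J"
proof -
  have J: "J \<subseteq> S" using assms by (simp add: finitary_def)
  have w: "w \<in> carrier W" using J assms by auto
  have le: "len v \<le> len w" if "v \<in> generate W J" for v
    using descents_add[OF J assms(2,3) that] by simp
  show ?thesis
    unfolding longest_def
  proof (rule the_equality[symmetric])
    show "w \<in> generate W J \<and> (\<forall>v\<in>generate W J. len v \<le> len w)"
      using le assms by auto
  next
    fix v assume v: "v \<in> generate W J \<and> (\<forall>u\<in>generate W J. len u \<le> len v)"
    then have vc: "v \<in> carrier W" using J by auto
    have "len v = len w" using v le assms(2) by (meson le_antisym)
    then have "len (inv v \<otimes> w) = 0"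
      using descents_add[OF J assms(2,3), of v] v by auto
    then have "inv v \<otimes> w = \<one>"
      using vc w len_eq_0_iff by auto
    then show "v = w"
      using vc w by (metis cancel_inv_left(2) r_one)
  qed
qed

lemma longest_props:
  assumes "finitary J"
  shows longest_in: "longest J \<in> generate W J"
    and longest_descent: "s \<in> J \<Longrightarrow> len (s \<otimes> longest J) < len (longest J)"
proof -
  have J: "J \<subseteq> S" "finite (generate W J)" using assms by (auto simp: finitary_def)
  have "finite (len ` generate W J)" "len ` generate W J \<noteq> {}"
    using J generate.one[of W J] by auto
  from Max_in[OF this] obtain w where w: "w \<in> generate W J" "len w = Max (len ` generate W J)"
    by auto
  then have max: "len v \<le> len w" if "v \<in> generate W J" for v
    using that J by simp
  have desc: "len (s \<otimes> w) < len w" if "s \<in> J" for s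
  proof -
    have "s \<in> S" "w \<in> carrier W" using that J w by auto
    moreover have "len (s \<otimes> w) \<le> len w"
      using that by (intro max generate_mult generate.incl w)
    ultimately show ?thesis
      using len_left_cases[of s w] by (metis lessI not_less)
  qed
  have eq: "w = longest J"
    using longest_unique[OF assms w(1)] desc by blast
  show "longest J \<in> generate W J" using w eq by simp
  show "s \<in> J \<Longrightarrow> len (s \<otimes> longest J) < len (longest J)" using desc eq by simp
qed

lemma longest_closed [simp]: "finitary J \<Longrightarrow> longest J \<in> carrier W"
  using longest_in finitary_def by auto

lemma longest_len_left:
  assumes "finitary J" "v \<in> generate W J"
  shows "len v + len (v \<otimes> longest J) = len (longest J)"
proof -
  have J: "J \<subseteq> S" using assms by (auto simp: finitary_def)
  then have "v \<in> carrier W" using assms by auto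
  then show ?thesis
    using descents_add[OF J longest_in longest_descent, of "inv v"] assms generate_inv[OF J]
    by simp
qed

text \<open>The inverse has all left descents: \<open>s w\<^sup>-\<^sup>1 = (w s)\<^sup>-\<^sup>1\<close>, and the length of \<open>w s\<close> is that of
  \<open>w\<close> minus that of \<open>(w s)\<^sup>-\<^sup>1 w = s\<close>.\<close>
lemma longest_inv [simp]:
  assumes "finitary J"
  shows "inv (longest J) = longest J"
proof (rule longest_unique[OF assms])
  let ?w = "longest J"
  have J: "J \<subseteq> S" using assms by (auto simp: finitary_def)
  show "inv ?w \<in> generate W J"
    using assms J generate_inv longest_in by auto
  fix s assume s: "s \<in> J"
  have sw: "?w \<otimes> s \<in> generate W J"
    using s generate_mult generate.incl longest_in assms by metis
  then have c: "?w \<otimes> s \<in> carrier W" using J by auto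
  have "len (inv (?w \<otimes> s) \<otimes> ?w) = len s"
    using s J assms by (auto simp: inv_mult_group m_assoc)
  moreover have "len (inv (?w \<otimes> s)) + len (inv (?w \<otimes> s) \<otimes> ?w) = len ?w"
    using sw J assms generate_inv by (intro longest_len_left) auto
  moreover have "len (inv (?w \<otimes> s)) = len (s \<otimes> inv ?w)"
    using s J assms by (auto simp: inv_mult_group)
  ultimately show "len (s \<otimes> inv ?w) < len (inv ?w)"
    using s J assms by auto
qed

lemma longest_len_right:
  assumes "finitary J" "v \<in> generate W J"
  shows "len v + len (longest J \<otimes> v) = len (longest J)"
proof -
  have J: "J \<subseteq> S" using assms by (auto simp: finitary_def)
  then have v: "v \<in> carrier W" using assms by auto
  then have "len (longest J \<otimes> v) = len (inv (longest J \<otimes> v))"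
    using assms by simp
  also have "\<dots> = len (inv v \<otimes> longest J)"
    using v assms by (simp add: inv_mult_group)
  finally show ?thesis
    using longest_len_left[OF assms(1), of "inv v"] assms J generate_inv v by auto
qed

lemma longest_right_descent: "\<lbrakk>finitary J; s \<in> J\<rbrakk> \<Longrightarrow> len (longest J \<otimes> s) < len (longest J)"
  using longest_len_right[of J s] generate.incl[of s J W] by (auto simp: finitary_def subset_iff)

lemma longest_unique_right:
  assumes "finitary J" "w \<in> generate W J" "\<And>s. s \<in> J \<Longrightarrow> len (w \<otimes> s) < len w"
  shows "w = longest J"
proof -
  have J: "J \<subseteq> S" using assms by (simp add: finitary_def)
  have w: "w \<in> carrier W" using J assms by auto
  have "inv w = longest J"
  proof (rule longest_unique[OF assms(1)])
    show "inv w \<in> generate W J" using assms J generate_inv by auto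
    fix s assume s: "s \<in> J"
    have "len (s \<otimes> inv w) = len (inv (w \<otimes> s))"
      using s J w by (subst inv_mult_group) auto
    then show "len (s \<otimes> inv w) < len (inv w)"
      using assms(3)[OF s] s J w by auto
  qed
  then show ?thesis using assms w by (metis inv_inv longest_inv)
qed

section \<open>Minimal and maximal elements of double cosets\<close>

abbreviation coset_redundancy :: "'a set \<Rightarrow> 'a set \<Rightarrow> 'a \<Rightarrow> 'a set" where
  "coset_redundancy J I x \<equiv> J \<inter> (\<lambda>s. x \<otimes> s \<otimes> inv x) ` I"

definition biminimal :: "'a set \<Rightarrow> 'a set \<Rightarrow> 'a \<Rightarrow> bool" where
  "biminimal J I x \<longleftrightarrow> x \<in> carrier W \<and> left_minimal J x \<and> right_minimal I x"

text \<open>This allows one to move elements of \<open>W\<^sub>K\<close> from the left of \<open>x\<close> to its right.\<close>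
lemma redundancy_conj:
  assumes "J \<subseteq> S" "I \<subseteq> S" "x \<in> carrier W" "k \<in> generate W (coset_redundancy J I x)"
  shows "inv x \<otimes> k \<otimes> x \<in> generate W I"
  using assms(4)
proof induction
  case one
  show ?case using assms generate.one by simp
next
  case (incl h)
  then obtain t where "t \<in> I" "h = x \<otimes> t \<otimes> inv x" by blast
  moreover from this have "inv x \<otimes> h \<otimes> x = t"
    using assms by (subst conj_eq_iff) auto
  ultimately show ?case by (simp add: generate.incl)
next
  case (inv h)
  then have "inv h = h" using assms by auto
  moreover obtain t where "t \<in> I" "h = x \<otimes> t \<otimes> inv x" using inv by blast
  moreover from this have "inv x \<otimes> h \<otimes> x = t"
    using assms by (subst conj_eq_iff) auto
  ultimately show ?case by (simp add: generate.incl)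
next
  case (eng g h)
  have "coset_redundancy J I x \<subseteq> S" using assms by auto
  then have "g \<in> carrier W" "h \<in> carrier W" using eng by auto
  then have "inv x \<otimes> (g \<otimes> h) \<otimes> x = (inv x \<otimes> g \<otimes> x) \<otimes> (inv x \<otimes> h \<otimes> x)"
    using assms by (simp add: m_assoc)
  then show ?case using eng generate_mult by simp
qed

text \<open>The point is that \<open>v x\<close> is again right minimal. Otherwise exchange gives \<open>v x s = v' x\<close>
  with \<open>v'\<close> shorter than \<open>v\<close>. Then \<open>r = v\<^sup>-\<^sup>1 v'\<close> satisfies \<open>r x = x s\<close>, so \<open>r\<close> has length 1 and lies
  in \<open>K\<close>, and \<open>v r = v'\<close> contradicts the minimality of \<open>v\<close> in \<open>v W\<^sub>K\<close>.\<close>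
lemma biminimal_add:
  assumes "J \<subseteq> S" "I \<subseteq> S" "biminimal J I x"
    and "v \<in> generate W J" "right_minimal (coset_redundancy J I x) v" "b \<in> generate W I"
  shows "len (v \<otimes> x \<otimes> b) = len v + len x + len b"
proof -
  have x: "x \<in> carrier W" "left_minimal J x" "right_minimal I x"
    using assms by (auto simp: biminimal_def)
  have v: "v \<in> carrier W" using assms by auto
  have "right_minimal I (v \<otimes> x)"
    unfolding right_minimal_def
  proof (intro ballI, rule ccontr)
    fix s assume s: "s \<in> I" and not_less: "\<not> len (v \<otimes> x) < len (v \<otimes> x \<otimes> s)"
    have S: "s \<in> S" using s assms by auto
    have xs: "len x < len (x \<otimes> s)"
      using x s by (auto simp: right_minimal_def)
    then obtain v' where v': "v' \<in> generate W J" "len v' < len v" "v \<otimes> x \<otimes> s = v' \<otimes> x"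
      using exchange_product_right[OF assms(1,4) x(1) S] not_less by auto
    have v'c: "v' \<in> carrier W" using v' assms by auto
    define r where "r = inv v \<otimes> v'"
    have r: "r \<in> generate W J" "r \<in> carrier W"
      using generate_mult generate_inv assms v' v v'c by (auto simp: r_def)
    have "r \<otimes> x = inv v \<otimes> (v \<otimes> x \<otimes> s)"
      unfolding v'(3) using v v'c x by (simp add: r_def m_assoc)
    then have rx: "r \<otimes> x = x \<otimes> s"
      using v x S by (simp add: m_assoc)
    have "len r + len x = len (x \<otimes> s)"
      using left_minimal_add[OF assms(1) x(1,2) r(1)] rx by simp
    then have "len r = 1"
      using xs len_right_cases[OF S x(1)] by fastforce
    then have "r \<in> J" using generate_len_1 assms r by blast
    moreover have "r = x \<otimes> s \<otimes> inv x"
      using rx r x by (metis cancel_inv_right(1))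
    ultimately have "r \<in> coset_redundancy J I x"
      using s by blast
    then have "len v < len (v \<otimes> r)"
      using assms(5) by (simp add: right_minimal_def)
    moreover have "v \<otimes> r = v'"
      using v v'c by (simp add: r_def)
    ultimately show False using v'(2) by simp
  qed
  then show ?thesis
    using right_minimal_add[of I "v \<otimes> x" b] left_minimal_add[of J x v] assms x v by simp
qed

text \<open>Write \<open>a = v k\<close> with \<open>k \<in> W\<^sub>K\<close> and move \<open>k\<close> across \<open>x\<close>.\<close>
lemma biminimal_normal_form:
  assumes "J \<subseteq> S" "I \<subseteq> S" "x \<in> carrier W" "a \<in> generate W J" "b \<in> generate W I"
  obtains v c where "v \<in> generate W J" "right_minimal (coset_redundancy J I x) v"
    "c \<in> generate W I" "a \<otimes> x \<otimes> b = v \<otimes> x \<otimes> c"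
proof -
  let ?K = "coset_redundancy J I x"
  have K: "?K \<subseteq> S" "?K \<subseteq> J" using assms by auto
  have a: "a \<in> carrier W" "b \<in> carrier W" using assms by auto
  obtain k v where k: "k \<in> generate W ?K" "v \<in> carrier W" "right_minimal ?K v" "a = v \<otimes> k"
    using right_minimal_decomposition[OF K(1) a(1)] .
  have kJ: "k \<in> generate W J" using mono_generate[OF K(2)] k by blast
  have kc: "k \<in> carrier W" using kJ assms by auto
  have "v = a \<otimes> inv k" using k kc a by simp
  then have v: "v \<in> generate W J"
    using kJ assms generate_inv generate_mult by simp
  have "a \<otimes> x \<otimes> b = v \<otimes> x \<otimes> ((inv x \<otimes> k \<otimes> x) \<otimes> b)"
    using k kc a assms by (simp add: m_assoc)
  then show ?thesis
    using that[OF v k(3), of "(inv x \<otimes> k \<otimes> x) \<otimes> b"]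
      generate_mult[OF redundancy_conj[OF assms(1,2,3) k(1)] assms(5)] by simp
qed

text \<open>In the normal form \<open>v x c\<close>, a left descent of \<open>v\<close> would be one of the whole product.\<close>
lemma left_minimal_normal_form:
  assumes "J \<subseteq> S" "I \<subseteq> S" "biminimal J I x" "a \<in> generate W J" "b \<in> generate W I"
    and "left_minimal J (a \<otimes> x \<otimes> b)"
  obtains c where "c \<in> generate W I" "a \<otimes> x \<otimes> b = x \<otimes> c"
proof -
  have x: "x \<in> carrier W" using assms by (auto simp: biminimal_def)
  obtain v c where v: "v \<in> generate W J" "right_minimal (coset_redundancy J I x) v"
    "c \<in> generate W I" "a \<otimes> x \<otimes> b = v \<otimes> x \<otimes> c"
    using biminimal_normal_form[OF assms(1,2) x assms(4,5)] .
  have vc: "v \<in> carrier W" "c \<in> carrier W" using v assms by auto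
  have len: "len (v \<otimes> x \<otimes> c) = len v + len x + len c"
    using biminimal_add assms v by blast
  have "v = \<one>"
  proof (rule ccontr)
    assume "v \<noteq> \<one>"
    then obtain s where s: "s \<in> J" "s \<otimes> v \<in> generate W J" "len v = Suc (len (s \<otimes> v))"
      using left_descent_exists assms v by metis
    then have "s \<otimes> (v \<otimes> x \<otimes> c) = (s \<otimes> v) \<otimes> x \<otimes> c" and S: "s \<in> S"
      using vc x assms by (auto simp: m_assoc)
    then have "len (s \<otimes> (v \<otimes> x \<otimes> c)) \<le> len (s \<otimes> v) + len x + len c"
      using len_mult_le[of "s \<otimes> v \<otimes> x" c] len_mult_le[of "s \<otimes> v" x] vc x by simp
    moreover have "len (v \<otimes> x \<otimes> c) < len (s \<otimes> (v \<otimes> x \<otimes> c))"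
      using assms(6) s v by (simp add: left_minimal_def)
    ultimately show False using len s by simp
  qed
  then show ?thesis using that v vc x by simp
qed

lemma biminimal_unique:
  assumes "J \<subseteq> S" "I \<subseteq> S" "biminimal J I x" "a \<in> generate W J" "b \<in> generate W I"
    and "biminimal J I (a \<otimes> x \<otimes> b)"
  shows "a \<otimes> x \<otimes> b = x"
proof -
  let ?y = "a \<otimes> x \<otimes> b"
  have x: "x \<in> carrier W" "right_minimal I x" using assms by (auto simp: biminimal_def)
  obtain c where c: "c \<in> generate W I" "?y = x \<otimes> c"
    using left_minimal_normal_form assms unfolding biminimal_def by metis
  have cc: "c \<in> carrier W" "inv c \<in> generate W I" using c assms generate_inv by auto
  have "len ?y = len x + len c"
    using right_minimal_add x c assms by simp
  moreover have "len x = len ?y + len (inv c)"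
    using right_minimal_add[of I ?y "inv c"] x c cc assms by (simp add: biminimal_def)
  ultimately have "len c = 0" by simp
  then show ?thesis using c cc x len_eq_0_iff by simp
qed

text \<open>Left descents force \<open>M = w\<^sub>J m\<close> with \<open>m\<close> left minimal, hence \<open>m = x d\<close>. Splitting
  \<open>w\<^sub>J = (w\<^sub>J w\<^sub>K) w\<^sub>K\<close> and moving \<open>w\<^sub>K\<close> across \<open>x\<close> gives the normal form \<open>(w\<^sub>J w\<^sub>K) x e\<close>, in which
  right descents force \<open>e = w\<^sub>I\<close>.\<close>
lemma bimaximal_formula:
  assumes "finitary J" "finitary I" "biminimal J I x" "a \<in> generate W J" "b \<in> generate W I"
    and M: "M = a \<otimes> x \<otimes> b"
    and left: "\<And>s. s \<in> J \<Longrightarrow> len (s \<otimes> M) < len M"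
    and right: "\<And>s. s \<in> I \<Longrightarrow> len (M \<otimes> s) < len M"
  shows "M = longest J \<otimes> longest (coset_redundancy J I x) \<otimes> x \<otimes> longest I"
    and "len M + len (longest (coset_redundancy J I x)) = len (longest J) + len x + len (longest I)"
proof -
  let ?K = "coset_redundancy J I x"
  have J: "J \<subseteq> S" "I \<subseteq> S" using assms by (auto simp: finitary_def)
  have K: "finitary ?K" "?K \<subseteq> J" using finitary_subset[OF assms(1)] by auto
  then have KS: "?K \<subseteq> S" using J by blast
  have x: "x \<in> carrier W" using assms by (auto simp: biminimal_def)
  have ab: "a \<in> carrier W" "b \<in> carrier W" using assms J by auto
  have Mc: "M \<in> carrier W" using M ab x by simp
  obtain c m where c: "c \<in> generate W J" "m \<in> carrier W" "left_minimal J m" "M = c \<otimes> m"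
    using left_minimal_decomposition[OF J(1) Mc] .
  have cc: "c \<in> carrier W" using c J by auto
  have c_longest: "c = longest J"
  proof (rule longest_unique[OF assms(1) c(1)])
    fix s assume s: "s \<in> J"
    have "s \<otimes> M = (s \<otimes> c) \<otimes> m" using c s cc J by (auto simp: m_assoc)
    moreover have "s \<otimes> c \<in> generate W J" using s c generate_mult generate.incl by metis
    ultimately have "len (s \<otimes> M) = len (s \<otimes> c) + len m"
      using left_minimal_add[OF J(1) c(2,3)] by metis
    then show "len (s \<otimes> c) < len c"
      using left[OF s] left_minimal_add[OF J(1) c(2,3,1)] c(4) by simp
  qed
  have "m = inv c \<otimes> M"
    using c cc by simp
  then have m: "m = (inv c \<otimes> a) \<otimes> x \<otimes> b"
    unfolding M using cc ab x by (simp add: m_assoc)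
  have ca: "inv c \<otimes> a \<in> generate W J"
    using generate_mult generate_inv J c assms by simp
  obtain d where d: "d \<in> generate W I" "m = x \<otimes> d"
    using left_minimal_normal_form[OF J assms(3) ca assms(5)] c(3) m by metis
  define v where "v = longest J \<otimes> longest ?K"
  define e where "e = inv x \<otimes> longest ?K \<otimes> x \<otimes> d"
  have KJ: "longest ?K \<in> generate W J"
    using mono_generate[OF K(2)] longest_in[OF K(1)] by blast
  have v: "v \<in> generate W J"
    unfolding v_def using KJ longest_in[OF assms(1)] generate_mult by blast
  have wk: "longest ?K \<otimes> longest ?K = \<one>"
    using longest_inv[OF K(1)] longest_closed[OF K(1)] by (metis r_inv)
  have e: "e \<in> generate W I"
    unfolding e_def using redundancy_conj[OF J x longest_in[OF K(1)]] d generate_mult by blast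
  have dc: "d \<in> carrier W" "e \<in> carrier W" "v \<in> carrier W" "longest ?K \<in> carrier W"
    "longest J \<in> carrier W"
    using d e v J K assms by auto
  have "longest ?K \<otimes> (longest ?K \<otimes> z) = z" if "z \<in> carrier W" for z
    using that dc wk by (simp flip: m_assoc)
  then have Mv: "M = v \<otimes> x \<otimes> e"
    using c(4) c_longest d dc x unfolding v_def e_def by (simp add: m_assoc)
  have v_min: "right_minimal ?K v"
    unfolding right_minimal_def
  proof
    fix s assume s: "s \<in> ?K"
    have S: "s \<in> S" using s KS by auto
    have "s \<in> generate W J" using s by (intro generate.incl) blast
    with KJ have 1: "longest ?K \<otimes> s \<in> generate W J"
      by (rule generate_mult)
    have 11: "v \<otimes> s = longest J \<otimes> (longest ?K \<otimes> s)"
      using dc S by (simp add: v_def m_assoc)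
    have 2: "len (longest ?K \<otimes> s) + len (v \<otimes> s) = len (longest J)"
      using longest_len_right[OF assms(1) 1] 11 by simp
    have 3: "len (longest ?K) + len v = len (longest J)"
      using longest_len_right[OF assms(1) KJ] by (simp add: v_def)
    show "len v < len (v \<otimes> s)"
      using longest_right_descent[OF K(1) s] 2 3 by linarith
  qed
  have e_longest: "e = longest I"
  proof (rule longest_unique_right[OF assms(2) e])
    fix s assume s: "s \<in> I"
    have es: "e \<otimes> s \<in> generate W I" using s e generate_mult generate.incl by metis
    have "M \<otimes> s = v \<otimes> x \<otimes> (e \<otimes> s)"
      using Mv dc s J x by (auto simp: m_assoc)
    then have "len (M \<otimes> s) = len v + len x + len (e \<otimes> s)"
      using biminimal_add[OF J assms(3) v v_min es] by simp
    then show "len (e \<otimes> s) < len e"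
      using biminimal_add[OF J assms(3) v v_min e] right[OF s] Mv by simp
  qed
  show "M = longest J \<otimes> longest ?K \<otimes> x \<otimes> longest I"
    using Mv e_longest v_def by simp
  show "len M + len (longest ?K) = len (longest J) + len x + len (longest I)"
    using biminimal_add[OF J assms(3) v v_min e] Mv e_longest longest_len_right[OF assms(1) KJ]
    by (simp add: v_def)
qed

section \<open>Simple reflections in the Bruhat order\<close>

lemma bruhat_le_len: "bruhat_le x y \<Longrightarrow> x = y \<or> len x < len y"
  unfolding bruhat_le_def by (induction rule: rtranclp_induct) auto

lemma bruhat_less_len: "bruhat_less x y \<Longrightarrow> len x < len y"
  using bruhat_le_len by (auto simp: bruhat_less_def)

lemma bruhat_less_right_iff:
  assumes "x \<in> carrier W" "s \<in> S"
  shows "bruhat_less x (x \<otimes> s) \<longleftrightarrow> len x < len (x \<otimes> s)"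
proof
  assume less: "len x < len (x \<otimes> s)"
  have "s \<in> reflections"
    using assms unfolding reflections_def by (intro CollectI exI[of _ \<one>] exI[of _ s]) simp
  then have "bruhat_le x (x \<otimes> s)"
    unfolding bruhat_le_def using assms less by (intro r_into_rtranclp) auto
  then show "bruhat_less x (x \<otimes> s)"
    using less by (auto simp: bruhat_less_def)
qed (rule bruhat_less_len)

lemma bruhat_less_left_iff:
  assumes "x \<in> carrier W" "s \<in> S"
  shows "bruhat_less x (s \<otimes> x) \<longleftrightarrow> len x < len (s \<otimes> x)"
proof
  assume less: "len x < len (s \<otimes> x)"
  have "inv x \<otimes> s \<otimes> x \<in> reflections"
    using assms unfolding reflections_def by (intro CollectI exI[of _ "inv x"] exI[of _ s]) simp
  moreover have "s \<otimes> x = x \<otimes> (inv x \<otimes> s \<otimes> x)"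
    using assms by (simp add: m_assoc)
  ultimately have "bruhat_le x (s \<otimes> x)"
    unfolding bruhat_le_def using assms less by (intro r_into_rtranclp) blast
  then show "bruhat_less x (s \<otimes> x)"
    using less by (auto simp: bruhat_less_def)
qed (rule bruhat_less_len)

section \<open>Double cosets\<close>

abbreviation double_coset :: "'a set \<Rightarrow> 'a set \<Rightarrow> 'a \<Rightarrow> 'a set" where
  "double_coset J I x \<equiv> (generate W J #> x) <#> generate W I"

lemma double_coset_iff:
  "y \<in> double_coset J I x \<longleftrightarrow> (\<exists>a\<in>generate W J. \<exists>b\<in>generate W I. y = a \<otimes> x \<otimes> b)"
  by (auto simp: set_mult_def r_coset_def)

lemma double_coset_self: "x \<in> carrier W \<Longrightarrow> x \<in> double_coset J I x"
  unfolding double_coset_iff using generate.one by (intro bexI[of _ \<one>]) auto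

lemma double_coset_closed:
  "\<lbrakk>J \<subseteq> S; I \<subseteq> S; x \<in> carrier W; y \<in> double_coset J I x\<rbrakk> \<Longrightarrow> y \<in> carrier W"
  unfolding double_coset_iff by (blast intro: generate_closed)

lemma double_coset_mult:
  assumes "J \<subseteq> S" "I \<subseteq> S" "x \<in> carrier W" "y \<in> double_coset J I x"
    and "a \<in> generate W J" "b \<in> generate W I"
  shows "a \<otimes> y \<otimes> b \<in> double_coset J I x"
proof -
  obtain c d where c: "c \<in> generate W J" "d \<in> generate W I" "y = c \<otimes> x \<otimes> d"
    using assms(4) unfolding double_coset_iff by blast
  moreover have "a \<in> carrier W" "b \<in> carrier W" "c \<in> carrier W" "d \<in> carrier W"
    using assms c by auto
  ultimately have "a \<otimes> y \<otimes> b = (a \<otimes> c) \<otimes> x \<otimes> (d \<otimes> b)"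
    using assms by (simp add: m_assoc)
  then show ?thesis
    unfolding double_coset_iff using c assms generate_mult by blast
qed

lemma double_coset_sym:
  assumes "J \<subseteq> S" "I \<subseteq> S" "x \<in> carrier W" "y \<in> double_coset J I x"
  shows "x \<in> double_coset J I y"
proof -
  obtain c d where c: "c \<in> generate W J" "d \<in> generate W I" "y = c \<otimes> x \<otimes> d"
    using assms(4) unfolding double_coset_iff by blast
  have "c \<in> carrier W" "d \<in> carrier W" using assms c by auto
  then have "x = inv c \<otimes> y \<otimes> inv d"
    unfolding c(3) using assms by (simp add: m_assoc)
  then show ?thesis
    unfolding double_coset_iff using c assms generate_inv by blast
qed

lemma double_coset_eq:
  assumes "J \<subseteq> S" "I \<subseteq> S" "x \<in> carrier W" "y \<in> double_coset J I x"
  shows "double_coset J I y = double_coset J I x"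
proof -
  have *: "double_coset J I z \<subseteq> double_coset J I x"
    if "x \<in> carrier W" "z \<in> double_coset J I x" for x z
  proof
    fix w assume "w \<in> double_coset J I z"
    then obtain a b where "a \<in> generate W J" "b \<in> generate W I" "w = a \<otimes> z \<otimes> b"
      unfolding double_coset_iff by blast
    then show "w \<in> double_coset J I x"
      using double_coset_mult[OF assms(1,2) that] by simp
  qed
  have "y \<in> carrier W" using assms double_coset_closed by blast
  then show ?thesis
    using *[of x y] *[of y x] double_coset_sym[OF assms] assms by blast
qed

lemma the_double_coset:
  assumes "J \<subseteq> S" "I \<subseteq> S" "z \<in> carrier W"
  shows "(THE p. p \<in> double_cosets J I \<and> z \<in> p) = double_coset J I z"
proof (rule the_equality)
  show "double_coset J I z \<in> double_cosets J I \<and> z \<in> double_coset J I z"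
    using assms double_coset_self by (auto simp: double_cosets_def)
  fix p assume p: "p \<in> double_cosets J I \<and> z \<in> p"
  then obtain x where "x \<in> carrier W" "p = double_coset J I x"
    by (auto simp: double_cosets_def)
  then show "p = double_coset J I z"
    using double_coset_eq[OF assms(1,2)] p by metis
qed

lemma double_coset_mono:
  assumes "I \<subseteq> I'"
  shows "double_coset J I z \<subseteq> double_coset J I' z"
  unfolding subset_iff double_coset_iff using mono_generate[OF assms] by blast

lemma the_double_coset_superset:
  assumes "J \<subseteq> S" "I \<subseteq> I'" "I' \<subseteq> S" "z \<in> carrier W"
  shows "(THE p. p \<in> double_cosets J I' \<and> double_coset J I z \<subseteq> p) = double_coset J I' z"
proof (rule the_equality)
  show "double_coset J I' z \<in> double_cosets J I' \<and> double_coset J I z \<subseteq> double_coset J I' z"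
    using assms double_coset_mono by (auto simp: double_cosets_def)
  fix p assume p: "p \<in> double_cosets J I' \<and> double_coset J I z \<subseteq> p"
  then obtain x where "x \<in> carrier W" "p = double_coset J I' x"
    by (auto simp: double_cosets_def)
  moreover have "z \<in> p" using p assms double_coset_self by blast
  ultimately show "p = double_coset J I' z"
    using double_coset_eq[OF assms(1,3)] by metis
qed

text \<open>Being Bruhat extremal in a double coset will be replaced by the condition on descents, which
  determines the element of the double coset.\<close>
definition bimaximal :: "'a set \<Rightarrow> 'a set \<Rightarrow> 'a \<Rightarrow> bool" where
  "bimaximal J I x \<longleftrightarrow> (\<forall>s\<in>J. len (s \<otimes> x) < len x) \<and> (\<forall>s\<in>I. len (x \<otimes> s) < len x)"

lemma double_coset_S:
  assumes "J \<subseteq> S" "I \<subseteq> S" "x \<in> carrier W" "y \<in> double_coset J I x"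
  shows "s \<in> J \<Longrightarrow> s \<otimes> y \<in> double_coset J I x"
    and "s \<in> I \<Longrightarrow> y \<otimes> s \<in> double_coset J I x"
proof -
  have y: "y \<in> carrier W" using assms double_coset_closed by blast
  show "s \<otimes> y \<in> double_coset J I x" if "s \<in> J"
    using double_coset_mult[OF assms, of s \<one>] that generate.incl[of s J W] generate.one[of W I] assms y
    by (metis S_carrier m_closed r_one subsetD)
  show "y \<otimes> s \<in> double_coset J I x" if "s \<in> I"
    using double_coset_mult[OF assms, of \<one> s] that generate.incl[of s I W] generate.one[of W J] assms y
    by (metis l_one)
qed

text \<open>An element of least length shows existence. Any Bruhat minimal element is biminimal, since
  multiplication by a simple reflection stays in the double coset, so uniqueness follows from
  \<open>biminimal_unique\<close>.\<close>
lemma min_elt_double_coset: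
  assumes "J \<subseteq> S" "I \<subseteq> S" "x \<in> carrier W"
  defines "p \<equiv> double_coset J I x"
  shows "min_elt p \<in> p" "biminimal J I (min_elt p)"
proof -
  have mult: "t \<otimes> y \<in> p" if "t \<in> J" "y \<in> p" for t y
    using that double_coset_S(1)[OF assms(1-3)] unfolding p_def by simp
  have mult': "y \<otimes> t \<in> p" if "t \<in> I" "y \<in> p" for t y
    using that double_coset_S(2)[OF assms(1-3)] unfolding p_def by simp
  have closed: "y \<in> carrier W" if "y \<in> p" for y
    using that double_coset_closed[OF assms(1-3)] unfolding p_def by simp
  have "x \<in> p" using double_coset_self assms(3) by (simp add: p_def)
  then obtain u where u: "u \<in> p" "\<And>y. y \<in> p \<Longrightarrow> len u \<le> len y"
    using ex_has_least_nat[of "\<lambda>y. y \<in> p" x len] by blast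
  have bimin: "biminimal J I y" if y: "y \<in> p" "\<not> (\<exists>z\<in>p. bruhat_less z y)" for y
    unfolding biminimal_def left_minimal_def right_minimal_def
  proof (intro conjI ballI)
    show yc: "y \<in> carrier W" using closed y by blast
    fix s assume s: "s \<in> J"
    then have S: "s \<in> S" using assms by blast
    have "s \<otimes> y \<in> p" using mult s y by blast
    then have "\<not> bruhat_less (s \<otimes> y) y" using y by blast
    then have "\<not> len (s \<otimes> y) < len y"
      using bruhat_less_left_iff[of "s \<otimes> y" s] yc S by simp
    then show "len y < len (s \<otimes> y)"
      using len_left_cases[OF S yc] by fastforce
  next
    have yc: "y \<in> carrier W" using closed y by blast
    fix s assume s: "s \<in> I"
    then have S: "s \<in> S" using assms by blast
    have "y \<otimes> s \<in> p" using mult' s y by blast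
    then have "\<not> bruhat_less (y \<otimes> s) y" using y by blast
    then have "\<not> len (y \<otimes> s) < len y"
      using bruhat_less_right_iff[of "y \<otimes> s" s] yc S by simp
    then show "len y < len (y \<otimes> s)"
      using len_right_cases[OF S yc] by fastforce
  qed
  have min: "u \<in> p \<and> \<not> (\<exists>y\<in>p. bruhat_less y u)"
    using u bruhat_less_len by (meson not_less)
  have eq: "min_elt p = u"
    unfolding min_elt_def
  proof (rule the_equality, rule min)
    fix y assume y: "y \<in> p \<and> \<not> (\<exists>z\<in>p. bruhat_less z y)"
    have "y \<in> double_coset J I u"
      using double_coset_eq[OF assms(1-3), of u] u y unfolding p_def by simp
    then obtain a b where "a \<in> generate W J" "b \<in> generate W I" "y = a \<otimes> u \<otimes> b"
      unfolding double_coset_iff by blast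
    then show "y = u"
      using biminimal_unique[OF assms(1,2)] bimin min y by blast
  qed
  show "min_elt p \<in> p" "biminimal J I (min_elt p)"
    unfolding eq using u bimin min by auto
qed

lemma bimaximal_unique:
  assumes "finitary J" "finitary I" "x \<in> carrier W"
    and "y \<in> double_coset J I x" "z \<in> double_coset J I x" "bimaximal J I y" "bimaximal J I z"
  shows "y = z"
proof -
  have JI: "J \<subseteq> S" "I \<subseteq> S" using assms by (auto simp: finitary_def)
  define u where "u = min_elt (double_coset J I x)"
  have u: "u \<in> double_coset J I x" "biminimal J I u"
    using min_elt_double_coset[OF JI assms(3)] by (auto simp: u_def)
  have "w = longest J \<otimes> longest (coset_redundancy J I u) \<otimes> u \<otimes> longest I"
    if w: "w \<in> double_coset J I x" "bimaximal J I w" for w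
  proof -
    have "w \<in> double_coset J I u"
      using double_coset_eq[OF JI assms(3) u(1)] w by blast
    then obtain a b where "a \<in> generate W J" "b \<in> generate W I" "w = a \<otimes> u \<otimes> b"
      unfolding double_coset_iff by blast
    then show ?thesis
      using bimaximal_formula(1)[OF assms(1,2) u(2)] w(2) unfolding bimaximal_def by blast
  qed
  then show ?thesis using assms by metis
qed

text \<open>The double coset is finite, so it has an element of greatest length; Bruhat maximal elements
  are bimaximal, hence unique.\<close>
lemma max_elt_double_coset:
  assumes "finitary J" "finitary I" "x \<in> carrier W"
  defines "p \<equiv> double_coset J I x"
  shows "max_elt p \<in> p" "bimaximal J I (max_elt p)"
proof -
  have JI: "J \<subseteq> S" "I \<subseteq> S" using assms by (auto simp: finitary_def)
  have mult: "t \<otimes> y \<in> p" if "t \<in> J" "y \<in> p" for t y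
    using that double_coset_S(1)[OF JI assms(3)] unfolding p_def by simp
  have mult': "y \<otimes> t \<in> p" if "t \<in> I" "y \<in> p" for t y
    using that double_coset_S(2)[OF JI assms(3)] unfolding p_def by simp
  have closed: "y \<in> carrier W" if "y \<in> p" for y
    using that double_coset_closed[OF JI assms(3)] unfolding p_def by simp
  have "p = (\<lambda>(a, b). a \<otimes> x \<otimes> b) ` (generate W J \<times> generate W I)"
    unfolding p_def set_eq_iff double_coset_iff by auto
  then have "finite p" using assms by (simp add: finitary_def)
  moreover have "p \<noteq> {}" using double_coset_self[OF assms(3)] unfolding p_def by blast
  ultimately have "Max (len ` p) \<in> len ` p" "\<And>y. y \<in> p \<Longrightarrow> len y \<le> Max (len ` p)"
    by auto
  then obtain u where u: "u \<in> p" "\<And>y. y \<in> p \<Longrightarrow> len y \<le> len u"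
    by auto
  have bimax: "bimaximal J I y" if y: "y \<in> p" "\<not> (\<exists>z\<in>p. bruhat_less y z)" for y
    unfolding bimaximal_def
  proof (intro conjI ballI)
    have yc: "y \<in> carrier W" using closed y by blast
    fix s assume s: "s \<in> J"
    then have S: "s \<in> S" using JI by blast
    have "s \<otimes> y \<in> p" using mult s y by blast
    then have "\<not> bruhat_less y (s \<otimes> y)" using y by blast
    then have "\<not> len y < len (s \<otimes> y)"
      using bruhat_less_left_iff[of y s] yc S by simp
    then show "len (s \<otimes> y) < len y"
      using len_left_cases[OF S yc] by fastforce
  next
    have yc: "y \<in> carrier W" using closed y by blast
    fix s assume s: "s \<in> I"
    then have S: "s \<in> S" using JI by blast
    have "y \<otimes> s \<in> p" using mult' s y by blast
    then have "\<not> bruhat_less y (y \<otimes> s)" using y by blast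
    then have "\<not> len y < len (y \<otimes> s)"
      using bruhat_less_right_iff[of y s] yc S by simp
    then show "len (y \<otimes> s) < len y"
      using len_right_cases[OF S yc] by fastforce
  qed
  have max: "u \<in> p \<and> \<not> (\<exists>y\<in>p. bruhat_less u y)"
    using u bruhat_less_len by (meson not_less)
  have eq: "max_elt p = u"
    unfolding max_elt_def
  proof (rule the_equality, rule max)
    fix y assume y: "y \<in> p \<and> \<not> (\<exists>z\<in>p. bruhat_less y z)"
    then show "y = u"
      using bimaximal_unique[OF assms(1-3), of y u] bimax max unfolding p_def by simp
  qed
  show "max_elt p \<in> p" "bimaximal J I (max_elt p)"
    unfolding eq using u bimax max by auto
qed

section \<open>The star product\<close>

definition up_right :: "'a \<Rightarrow> 'a \<Rightarrow> 'a" where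
  "up_right s x = (if len x < len (x \<otimes> s) then x \<otimes> s else x)"

definition up_left :: "'a \<Rightarrow> 'a \<Rightarrow> 'a" where
  "up_left s x = (if len x < len (s \<otimes> x) then s \<otimes> x else x)"

lemma up_closed [simp]:
  "\<lbrakk>s \<in> S; x \<in> carrier W\<rbrakk> \<Longrightarrow> up_right s x \<in> carrier W"
  "\<lbrakk>s \<in> S; x \<in> carrier W\<rbrakk> \<Longrightarrow> up_left s x \<in> carrier W"
  by (simp_all add: up_right_def up_left_def)

text \<open>Exchange writes \<open>s x t\<close> as \<open>a x\<close> with \<open>a\<close> shorter than \<open>s\<close>, so \<open>s x t = x\<close>.\<close>
lemma lifted_square:
  assumes "s \<in> S" "t \<in> S" "x \<in> carrier W"
    and "len x < len (s \<otimes> x)" "len x < len (x \<otimes> t)" "\<not> len (s \<otimes> x) < len (s \<otimes> x \<otimes> t)"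
  shows "s \<otimes> x = x \<otimes> t"
proof -
  have s: "s \<in> generate W {s}" by (intro generate.incl) simp
  have "\<exists>a\<in>generate W {s}. len a < len s \<and> s \<otimes> x \<otimes> t = a \<otimes> x"
    by (rule exchange_product_right) (use assms s in simp_all)
  then obtain a where a: "a \<in> generate W {s}" "len a < len s" "s \<otimes> x \<otimes> t = a \<otimes> x"
    by blast
  have "a \<in> carrier W" using a(1) generate_closed[of "{s}"] assms by auto
  then have "a = \<one>" using a(2) assms len_eq_0_iff by simp
  then have "s \<otimes> x \<otimes> t = x" using a assms by simp
  then show ?thesis
    using assms by (metis S_cancel_right S_carrier m_closed)
qed

text \<open>The lengths of \<open>x\<close>, \<open>s x\<close>, \<open>x t\<close> and \<open>s x t\<close> settle every case but one: if \<open>s x\<close> and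
  \<open>x t\<close> are longer than \<open>x\<close> while \<open>s x t\<close> is not longer than \<open>s x\<close>, the claim is \<open>s x = x t\<close>.\<close>
lemma up_left_right_commute:
  assumes "s \<in> S" "t \<in> S" "x \<in> carrier W"
  shows "up_left s (up_right t x) = up_right t (up_left s x)"
proof -
  have c: "s \<otimes> x \<in> carrier W" "x \<otimes> t \<in> carrier W" "s \<otimes> (x \<otimes> t) = s \<otimes> x \<otimes> t"
    using assms by (auto simp: m_assoc)
  consider "len (s \<otimes> x) = Suc (len x)" | "len x = Suc (len (s \<otimes> x))"
    using len_left_cases[OF assms(1,3)] by blast
  moreover consider "len (x \<otimes> t) = Suc (len x)" | "len x = Suc (len (x \<otimes> t))"
    using len_right_cases[OF assms(2,3)] by blast
  moreover consider "len (s \<otimes> x \<otimes> t) = Suc (len (x \<otimes> t))" | "len (x \<otimes> t) = Suc (len (s \<otimes> x \<otimes> t))"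
    using len_left_cases[OF assms(1) c(2)] c(3) by metis
  moreover consider "len (s \<otimes> x \<otimes> t) = Suc (len (s \<otimes> x))" | "len (s \<otimes> x) = Suc (len (s \<otimes> x \<otimes> t))"
    using len_right_cases[OF assms(2) c(1)] by metis
  moreover have "s \<otimes> x = x \<otimes> t"
    if "len x < len (s \<otimes> x)" "len x < len (x \<otimes> t)" "\<not> len (s \<otimes> x) < len (s \<otimes> x \<otimes> t)"
    using lifted_square assms that by blast
  ultimately show ?thesis
    unfolding up_left_def up_right_def using c(3) by (smt (verit) lessI less_SucI not_less_iff_gr_or_eq Suc_inject n_not_Suc_n)
qed

lemma fold_up_closed [simp]:
  "\<lbrakk>set u \<subseteq> S; x \<in> carrier W\<rbrakk> \<Longrightarrow> fold up_right u x \<in> carrier W"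
  by (induction u arbitrary: x) auto

lemma fold_up_left_commute:
  "\<lbrakk>set u \<subseteq> S; s \<in> S; x \<in> carrier W\<rbrakk> \<Longrightarrow> fold up_right u (up_left s x) = up_left s (fold up_right u x)"
  by (induction u arbitrary: x) (auto simp flip: up_left_right_commute)

lemma fold_up_foldr_commute:
  "\<lbrakk>set u \<subseteq> S; set v \<subseteq> S; x \<in> carrier W\<rbrakk> \<Longrightarrow>
    foldr up_left v x \<in> carrier W \<and> fold up_right u (foldr up_left v x) = foldr up_left v (fold up_right u x)"
  by (induction v) (auto simp: fold_up_left_commute)

lemma foldr_up_left_reduced:
  "\<lbrakk>set v \<subseteq> S; length v = len (word_prod v)\<rbrakk> \<Longrightarrow> foldr up_left v \<one> = word_prod v"
proof (induction v)
  case (Cons s v)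
  have "len (s \<otimes> word_prod v) \<le> Suc (len (word_prod v))"
    using len_mult_le[of s "word_prod v"] Cons.prems by auto
  then have "length v = len (word_prod v)"
    using Cons.prems len_word_prod_le[of v] by simp
  with Cons show ?case by (simp add: up_left_def)
qed simp

lemma fold_up_right_reduced:
  "\<lbrakk>set v \<subseteq> S; length v = len (word_prod v)\<rbrakk> \<Longrightarrow> fold up_right v \<one> = word_prod v"
proof (induction v rule: rev_induct)
  case (snoc s v)
  have c: "set v \<subseteq> carrier W" using snoc.prems S_closed by auto
  have eq: "word_prod (v @ [s]) = word_prod v \<otimes> s"
    using snoc.prems c word_prod_append[of v "[s]"] by auto
  have "len (word_prod v \<otimes> s) \<le> Suc (len (word_prod v))"
    using len_mult_le[of "word_prod v" s] snoc.prems by auto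
  then have "length v = len (word_prod v)"
    using snoc.prems len_word_prod_le[of v] eq by simp
  with snoc eq show ?case by (simp add: up_right_def)
qed simp

text \<open>An operator composed of right steps commutes with all left steps, and \<open>x\<close> is obtained from
  \<open>1\<close> by left steps. Hence the operator is determined by its value at \<open>1\<close>.\<close>
lemma fold_up_determined:
  assumes "set u \<subseteq> S" "set v \<subseteq> S" "fold up_right u \<one> = fold up_right v \<one>" "x \<in> carrier W"
  shows "fold up_right u x = fold up_right v x"
proof -
  obtain w where w: "set w \<subseteq> S" "length w = len x" "word_prod w = x"
    using reduced_word[OF assms(4)] .
  then have x: "x = foldr up_left w \<one>"
    using foldr_up_left_reduced by simp
  show ?thesis
    unfolding x using assms w fold_up_foldr_commute[of _ w \<one>] by simp
qed

text \<open>The unique composition of right steps that sends \<open>1\<close> to \<open>y\<close>, applied to \<open>x\<close>; by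
  \<open>fold_up_determined\<close> the choice of the word is immaterial.\<close>
definition demazure :: "'a \<Rightarrow> 'a \<Rightarrow> 'a" where
  "demazure x y = fold up_right (SOME u. set u \<subseteq> S \<and> length u = len y \<and> word_prod u = y) x"

lemma demazure_fold:
  assumes "set u \<subseteq> S" "x \<in> carrier W"
  shows "demazure x (fold up_right u \<one>) = fold up_right u x"
proof -
  let ?y = "fold up_right u \<one>"
  define v where "v = (SOME v. set v \<subseteq> S \<and> length v = len ?y \<and> word_prod v = ?y)"
  have "\<exists>v. set v \<subseteq> S \<and> length v = len ?y \<and> word_prod v = ?y"
    by (rule reduced_word[OF fold_up_closed[OF assms(1) one_closed]]) blast
  then have v: "set v \<subseteq> S \<and> length v = len ?y \<and> word_prod v = ?y"
    unfolding v_def by (rule someI_ex)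
  then have "fold up_right v \<one> = ?y"
    using fold_up_right_reduced[of v] by simp
  then have "fold up_right v x = fold up_right u x"
    using fold_up_determined[of v u x] v assms by blast
  then show ?thesis by (simp add: demazure_def v_def)
qed

lemma fold_up_surj:
  assumes "y \<in> carrier W"
  obtains u where "set u \<subseteq> S" "y = fold up_right u \<one>"
  using reduced_word[OF assms] fold_up_right_reduced by metis

text \<open>Associativity is associativity of composition: the operator of \<open>y * z\<close> is the operator of
  \<open>z\<close> after that of \<open>y\<close>, as both send \<open>1\<close> to \<open>y * z\<close>.\<close>
lemma is_star_product_demazure: "is_star_product demazure"
  unfolding is_star_product_def
proof (intro conjI ballI)
  show "monoid \<lparr>carrier = carrier W, monoid.mult = demazure, one = \<one>\<rparr>"
  proof (rule monoidI; simp)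
    fix x y assume x: "x \<in> carrier W" and y: "y \<in> carrier W"
    obtain u where u: "set u \<subseteq> S" "y = fold up_right u \<one>" using fold_up_surj[OF y] .
    show "demazure x y \<in> carrier W" using u x demazure_fold by simp
    fix z assume z: "z \<in> carrier W"
    obtain v where v: "set v \<subseteq> S" "z = fold up_right v \<one>" using fold_up_surj[OF z] .
    have "demazure y z = fold up_right (u @ v) \<one>"
      using u v y demazure_fold by simp
    then have "demazure x (demazure y z) = fold up_right (u @ v) x"
      using demazure_fold[of "u @ v" x] u v x by simp
    then show "demazure (demazure x y) z = demazure x (demazure y z)"
      using u v x demazure_fold by simp
  next
    fix x assume x: "x \<in> carrier W"
    obtain u where u: "set u \<subseteq> S" "x = fold up_right u \<one>" using fold_up_surj[OF x] .
    show "demazure \<one> x = x" using u demazure_fold by simp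
    show "demazure x \<one> = x" using x demazure_fold[of "[]" x] by simp
  qed
next
  fix x s assume x: "x \<in> carrier W" and s: "s \<in> S"
  have "demazure x s = up_right s x"
    using demazure_fold[of "[s]" x] s x by (simp add: up_right_def)
  then show "bruhat_less x (x \<otimes> s) \<longrightarrow> demazure x s = x \<otimes> s"
    "bruhat_less (x \<otimes> s) x \<longrightarrow> demazure x s = x"
    using bruhat_less_len by (fastforce simp: up_right_def)+
qed

lemma star_monoid: "monoid \<lparr>carrier = carrier W, monoid.mult = star, one = \<one>\<rparr>"
  and star_up_right: "\<lbrakk>x \<in> carrier W; s \<in> S\<rbrakk> \<Longrightarrow> star x s = up_right s x"
proof -
  have "is_star_product star"
    unfolding star_def using someI[of is_star_product, OF is_star_product_demazure] .
  then have *: "monoid \<lparr>carrier = carrier W, monoid.mult = star, one = \<one>\<rparr>"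
    "\<And>x s. \<lbrakk>x \<in> carrier W; s \<in> S; bruhat_less x (x \<otimes> s)\<rbrakk> \<Longrightarrow> star x s = x \<otimes> s"
    "\<And>x s. \<lbrakk>x \<in> carrier W; s \<in> S; bruhat_less (x \<otimes> s) x\<rbrakk> \<Longrightarrow> star x s = x"
    by (auto simp: is_star_product_def)
  show "monoid \<lparr>carrier = carrier W, monoid.mult = star, one = \<one>\<rparr>" by (rule *)
  assume xs: "x \<in> carrier W" "s \<in> S"
  show "star x s = up_right s x"
    using xs(2,1)
  proof (cases rule: len_right_cases)
    case 1
    then show ?thesis using *(2) xs bruhat_less_right_iff by (simp add: up_right_def)
  next
    case 2
    then have "bruhat_less (x \<otimes> s) x"
      using bruhat_less_right_iff[of "x \<otimes> s" s] xs by simp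
    then show ?thesis using 2 *(3) xs by (simp add: up_right_def)
  qed
qed

lemma star_closed [simp]: "\<lbrakk>x \<in> carrier W; y \<in> carrier W\<rbrakk> \<Longrightarrow> star x y \<in> carrier W"
  and star_assoc: "\<lbrakk>x \<in> carrier W; y \<in> carrier W; z \<in> carrier W\<rbrakk> \<Longrightarrow> star (star x y) z = star x (star y z)"
  and star_one_left [simp]: "x \<in> carrier W \<Longrightarrow> star \<one> x = x"
  and star_one_right [simp]: "x \<in> carrier W \<Longrightarrow> star x \<one> = x"
  using monoid.m_closed[OF star_monoid] monoid.m_assoc[OF star_monoid]
    monoid.l_one[OF star_monoid] monoid.r_one[OF star_monoid] by simp_all

text \<open>By induction on a reduced word of \<open>y\<close>: each letter lengthens the star product by at most
  one, and by exactly one only if it acts by ordinary multiplication.\<close>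
lemma star_props:
  assumes x: "x \<in> carrier W" and "y \<in> carrier W"
  shows star_len_le: "len (star x y) \<le> len x + len y"
    and star_eq_mult: "len (star x y) = len x + len y \<Longrightarrow> star x y = x \<otimes> y"
    and star_reduced: "len (x \<otimes> y) = len x + len y \<Longrightarrow> star x y = x \<otimes> y"
proof -
  have *: "len (star x y) \<le> len x + len y \<and>
      (len (star x y) = len x + len y \<or> len (x \<otimes> y) = len x + len y \<longrightarrow> star x y = x \<otimes> y)"
    if "set u \<subseteq> S" "length u = len (word_prod u)" "y = word_prod u" for u y
    using that
  proof (induction u arbitrary: y rule: rev_induct)
    case Nil
    then show ?case using x by simp
  next
    case (snoc s u)
    define z where "z = word_prod u"
    have s: "s \<in> S" and u: "set u \<subseteq> S" and z: "z \<in> carrier W" "set u \<subseteq> carrier W"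
      using snoc.prems S_closed by (auto simp: z_def)
    have y: "y = z \<otimes> s"
      using snoc.prems s z word_prod_append[of u "[s]"] by (simp add: z_def)
    have lu: "len z \<le> length u" "len y = Suc (length u)"
      using len_word_prod_le[OF u] snoc.prems by (auto simp: z_def)
    have "len y \<le> Suc (len z)"
      using len_mult_le[of z s] y s z by simp
    then have len_z: "len z = length u" using lu by simp
    then have "length u = len (word_prod u)" by (simp add: z_def)
    from snoc.IH[OF u this z_def]
    have IH: "len (star x z) \<le> len x + len z"
      "len (star x z) = len x + len z \<or> len (x \<otimes> z) = len x + len z \<longrightarrow> star x z = x \<otimes> z"
      by blast+
    have "star z s = y"
      using star_up_right[OF z(1) s] len_z lu y by (simp add: up_right_def)
    then have sy: "star x y = up_right s (star x z)"
      using star_assoc[OF x z(1), of s] star_up_right[OF star_closed[OF x z(1)] s] s by simp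
    have xy: "x \<otimes> y = x \<otimes> z \<otimes> s" using x y s z by (simp add: m_assoc)
    have le1: "len (star x z \<otimes> s) \<le> Suc (len (star x z))" "len (x \<otimes> y) \<le> Suc (len (x \<otimes> z))"
      using len_mult_le[of "star x z" s] len_mult_le[of "x \<otimes> z" s] s x z xy by simp_all
    have le2: "len (x \<otimes> z) \<le> len x + len z" using len_mult_le x z by simp
    have le3: "len (up_right s (star x z)) \<le> Suc (len (star x z))"
      using le1(1) by (simp add: up_right_def)
    have "up_right s (star x z) = x \<otimes> y"
      if h: "len (up_right s (star x z)) = len x + len y \<or> len (x \<otimes> y) = len x + len y"
    proof -
      have "len (star x z) = len x + len z \<or> len (x \<otimes> z) = len x + len z"
        using h IH(1) le1(2) le2 le3 lu len_z by linarith
      then have A: "star x z = x \<otimes> z" using IH(2) by blast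
      then have "len (x \<otimes> z) < len (x \<otimes> y)"
        using h IH(1) lu len_z xy by (auto simp: up_right_def split: if_splits)
      then show ?thesis
        unfolding A xy by (simp add: up_right_def)
    qed
    moreover have "len (up_right s (star x z)) \<le> len x + len y"
      using IH(1) le3 lu len_z by linarith
    ultimately show ?case
      unfolding sy by blast
  qed
  obtain u where "set u \<subseteq> S" "length u = len y" "word_prod u = y"
    using reduced_word[OF assms(2)] .
  then have "set u \<subseteq> S" "length u = len (word_prod u)" "y = word_prod u" by simp_all
  from *[OF this] show "len (star x y) \<le> len x + len y"
    "len (star x y) = len x + len y \<Longrightarrow> star x y = x \<otimes> y"
    "len (x \<otimes> y) = len x + len y \<Longrightarrow> star x y = x \<otimes> y"
    by blast+
qed

text \<open>If \<open>s x\<close> is shorter than \<open>x\<close>, then \<open>x = s * (s x)\<close>, and \<open>s * s = s\<close>.\<close>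
lemma star_up_left:
  assumes "x \<in> carrier W" "s \<in> S"
  shows "star s x = up_left s x"
  using assms(2,1)
proof (cases rule: len_left_cases)
  case 1
  then show ?thesis using star_reduced[of s x] assms by (simp add: up_left_def)
next
  case 2
  then have "star s (s \<otimes> x) = s \<otimes> (s \<otimes> x)"
    using assms by (intro star_reduced) auto
  then have x: "star s (s \<otimes> x) = x"
    using assms by simp
  have "star s s = s"
    using star_up_right[of s s] assms by (simp add: up_right_def)
  then have "star s x = x"
    using star_assoc[of s s "s \<otimes> x"] x assms by simp
  then show ?thesis using 2 by (simp add: up_left_def)
qed

lemma star_word_prod:
  assumes "x \<in> carrier W" "set u \<subseteq> S" "length u = len (word_prod u)"
  shows "star x (word_prod u) = fold up_right u x"
proof -
  have "star x (fold up_right u \<one>) = fold up_right u x"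
    using assms(2)
  proof (induction u rule: rev_induct)
    case (snoc s u)
    then have "star x (star (fold up_right u \<one>) s) = star (fold up_right u x) s"
      using star_assoc[of x "fold up_right u \<one>" s] assms by simp
    with snoc show ?case
      using assms by (simp add: star_up_right)
  qed (use assms in simp)
  then show ?thesis
    using fold_up_right_reduced assms by simp
qed

lemma star_generate:
  assumes "J \<subseteq> S" "x \<in> carrier W" "y \<in> generate W J"
  shows "\<exists>b\<in>generate W J. star x y = x \<otimes> b"
proof -
  have *: "\<exists>b\<in>generate W J. fold up_right u x = x \<otimes> b" if "set u \<subseteq> J" for u
    using that
  proof (induction u rule: rev_induct)
    case Nil
    then show ?case using assms generate.one by (intro bexI[of _ \<one>]) auto
  next
    case (snoc s u)
    then obtain b where b: "b \<in> generate W J" "fold up_right u x = x \<otimes> b" by auto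
    have s: "s \<in> generate W J"
      using snoc.prems by (intro generate.incl) simp
    then have "s \<in> carrier W" "b \<in> carrier W"
      using b assms by auto
    then have "x \<otimes> b \<otimes> s = x \<otimes> (b \<otimes> s)" using assms by (simp add: m_assoc)
    then have "fold up_right (u @ [s]) x \<in> {x \<otimes> b, x \<otimes> (b \<otimes> s)}"
      using b by (simp add: up_right_def)
    then show ?case
      using b s generate_mult[OF b(1) s] by blast
  qed
  obtain u where u: "set u \<subseteq> J" "length u = len y" "word_prod u = y"
    using reduced_word_generate[OF assms(1,3)] .
  then have "star x y = fold up_right u x"
    using star_word_prod[of x u] assms by auto
  then show ?thesis using *[OF u(1)] by simp
qed

lemma star_absorb:
  assumes "J \<subseteq> S" "x \<in> carrier W" "y \<in> generate W J" "\<And>s. s \<in> J \<Longrightarrow> len (x \<otimes> s) < len x"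
  shows "star x y = x"
proof -
  obtain u where u: "set u \<subseteq> J" "length u = len y" "word_prod u = y"
    using reduced_word_generate[OF assms(1,3)] .
  have "fold up_right u x = x"
    using u(1)
  proof (induction u)
    case (Cons s u)
    then show ?case using assms(4)[of s] by (simp add: up_right_def)
  qed simp
  then show ?thesis
    using star_word_prod[of x u] u assms by auto
qed

section \<open>Enlarging the right parabolic subgroup\<close>

lemma longest_parabolic_in:
  assumes "finitary I'" "I \<subseteq> I'"
  shows "longest I \<in> generate W I'"
  using mono_generate[OF assms(2)] longest_in[OF finitary_subset[OF assms]] by blast

lemma right_factor:
  assumes "finitary I'" "I \<subseteq> I'"
  defines "z \<equiv> inv (longest I) \<otimes> longest I'"
  shows "z \<in> carrier W" "len (longest I) + len z = len (longest I')"
    "star (longest I) z = longest I'"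
proof -
  have I: "finitary I" using finitary_subset assms by blast
  have w: "longest I \<in> carrier W" "longest I' \<in> carrier W" using I assms by auto
  show z: "z \<in> carrier W" using w by (simp add: z_def)
  have eq: "longest I \<otimes> z = longest I'"
    using w by (simp add: z_def)
  show len: "len (longest I) + len z = len (longest I')"
    using longest_len_left[OF assms(1) longest_parabolic_in[OF assms(1,2)]] I by (simp add: z_def)
  show "star (longest I) z = longest I'"
    using star_reduced[OF w(1) z] len eq by simp
qed

lemma left_factor:
  assumes "finitary I'" "I \<subseteq> I'"
  defines "y \<equiv> longest I' \<otimes> inv (longest I)"
  shows "y \<in> carrier W" "len y + len (longest I) = len (longest I')"
    "star y (longest I) = longest I'"
proof -
  have I: "finitary I" using finitary_subset assms by blast
  have w: "longest I \<in> carrier W" "longest I' \<in> carrier W" using I assms by auto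
  show y: "y \<in> carrier W" using w by (simp add: y_def)
  have eq: "y \<otimes> longest I = longest I'"
    unfolding y_def using w by (rule cancel_inv_right(2))
  show len: "len y + len (longest I) = len (longest I')"
    using longest_len_right[OF assms(1) longest_parabolic_in[OF assms(1,2)]] I by (simp add: y_def)
  show "star y (longest I) = longest I'"
    using star_reduced[OF y w(1)] len eq by simp
qed

lemma up_right_fixed:
  assumes "up_right s x = x" "s \<in> S" "x \<in> carrier W"
  shows "len (x \<otimes> s) < len x"
  using assms(2,3)
proof (cases rule: len_right_cases)
  case 1
  then have "x \<otimes> s = x" using assms(1) by (simp add: up_right_def)
  with 1 show ?thesis by simp
qed simp

lemma up_left_fixed:
  assumes "up_left s x = x" "s \<in> S" "x \<in> carrier W"
  shows "len (s \<otimes> x) < len x"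
  using assms(2,3)
proof (cases rule: len_left_cases)
  case 1
  then have "s \<otimes> x = x" using assms(1) by (simp add: up_left_def)
  with 1 show ?thesis by simp
qed simp

text \<open>The element \<open>M * w\<^bsub>I'\<^esub>\<close> lies in \<open>M W\<^bsub>I'\<^esub>\<close>, and it is fixed under star multiplication by \<open>J\<close>
  on the left and by \<open>I'\<close> on the right, so it is the maximal element. Finally \<open>w\<^bsub>I'\<^esub> = w\<^sub>I * z\<close>
  and \<open>w\<^sub>I\<close> is absorbed by \<open>M\<close>.\<close>
lemma max_elt_enlarge:
  assumes "finitary J" "finitary I'" "I \<subseteq> I'" "M \<in> carrier W" "bimaximal J I M"
  shows "max_elt (double_coset J I' M) = star M (inv (longest I) \<otimes> longest I')"
proof -
  let ?w = "longest I'" and ?z = "inv (longest I) \<otimes> longest I'"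
  let ?X = "star M ?w"
  have I: "finitary I" using finitary_subset assms by blast
  have S: "J \<subseteq> S" "I \<subseteq> S" "I' \<subseteq> S" using assms by (auto simp: finitary_def)
  have w: "?w \<in> carrier W" "longest I \<in> carrier W" "?X \<in> carrier W"
    using assms I by auto
  note z = right_factor[OF assms(2,3)]
  have "star M (longest I) = M"
    using star_absorb[OF S(2) assms(4) longest_in[OF I]] assms(5) by (simp add: bimaximal_def)
  then have Xz: "?X = star M ?z"
    using star_assoc[OF assms(4) w(2) z(1)] z(3) by simp
  have "bimaximal J I' ?X"
    unfolding bimaximal_def
  proof (intro conjI ballI)
    fix s assume s: "s \<in> J"
    then have sS: "s \<in> S" using S by blast
    have "len (s \<otimes> M) < len M" using assms(5) s by (simp add: bimaximal_def)
    then have "star s M = M"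
      using star_up_left[OF assms(4) sS] by (simp add: up_left_def)
    then have "up_left s ?X = ?X"
      using star_up_left[OF w(3) sS] star_assoc[of s M ?w] sS assms(4) w by simp
    then show "len (s \<otimes> ?X) < len ?X" using up_left_fixed sS w by blast
  next
    fix s assume s: "s \<in> I'"
    then have sS: "s \<in> S" using S by blast
    have "star ?w s = ?w"
      using star_up_right[OF w(1) sS] longest_right_descent[OF assms(2) s] by (simp add: up_right_def)
    then have "up_right s ?X = ?X"
      using star_up_right[OF w(3) sS] star_assoc[of M ?w s] sS assms(4) w by simp
    then show "len (?X \<otimes> s) < len ?X" using up_right_fixed sS w by blast
  qed
  moreover obtain b where "b \<in> generate W I'" "?X = M \<otimes> b"
    using star_generate[OF S(3) assms(4) longest_in[OF assms(2)]] by blast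
  then have "?X \<in> double_coset J I' M"
    unfolding double_coset_iff using generate.one[of W J] assms(4) by (intro bexI[of _ \<one>] bexI[of _ b]) auto
  ultimately show ?thesis
    using bimaximal_unique[OF assms(1,2,4)] max_elt_double_coset[OF assms(1,2,4)] Xz by metis
qed

text \<open>If \<open>s \<in> J\<close> and \<open>s u c = u c t\<close> with \<open>t \<in> I\<close>, then \<open>s u = u r\<close> with \<open>r = c t c\<^sup>-\<^sup>1\<close> in
  \<open>W\<^bsub>I'\<^esub>\<close>. Lengths add in \<open>u r\<close>, so \<open>r\<close> has length 1 and lies in \<open>I'\<close>.\<close>
lemma redundancy_mono:
  assumes "J \<subseteq> S" "I \<subseteq> I'" "I' \<subseteq> S" "biminimal J I' u" "c \<in> generate W I'"
  shows "coset_redundancy J I (u \<otimes> c) \<subseteq> coset_redundancy J I' u"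
proof
  fix s assume "s \<in> coset_redundancy J I (u \<otimes> c)"
  then obtain t where s: "s \<in> J" "t \<in> I" "s = (u \<otimes> c) \<otimes> t \<otimes> inv (u \<otimes> c)" by blast
  have u: "u \<in> carrier W" "left_minimal J u" "right_minimal I' u"
    using assms by (auto simp: biminimal_def)
  have c: "c \<in> carrier W" "t \<in> carrier W" "s \<in> S" using assms s by auto
  define r where "r = c \<otimes> t \<otimes> inv c"
  have "t \<in> generate W I'" using s assms by (intro generate.incl) blast
  then have r: "r \<in> generate W I'"
    unfolding r_def using generate_mult[OF generate_mult[OF assms(5)] generate_inv[OF assms(3,5)]] by blast
  have rc: "r \<in> carrier W" using r assms by auto
  have su: "s = u \<otimes> r \<otimes> inv u"
    using s u c by (simp add: r_def m_assoc inv_mult_group)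
  then have "s \<otimes> u = u \<otimes> r" using u rc by simp
  then have "len (s \<otimes> u) = len u + len r"
    using right_minimal_add[OF assms(3) u(1,3) r] by simp
  moreover have "len u < len (s \<otimes> u)" using u s by (simp add: left_minimal_def)
  moreover have "len (s \<otimes> u) \<le> Suc (len u)"
    using len_mult_le[of s u] c u by simp
  ultimately have "len r = 1" by simp
  then have "r \<in> I'" using generate_len_1[OF assms(3) r] by blast
  then show "s \<in> coset_redundancy J I' u" using su s by blast
qed

text \<open>If the lengths agree, the longest elements agree, and every \<open>s \<in> K'\<close> is a left descent of
  \<open>w\<^sub>K\<close>; exchange then puts \<open>s w\<^sub>K\<close>, and with it \<open>s\<close>, into \<open>W\<^sub>K\<close>.\<close>
lemma longest_len_mono:
  assumes "finitary K'" "K \<subseteq> K'"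
  shows "len (longest K) \<le> len (longest K')"
    and "len (longest K) = len (longest K') \<Longrightarrow> K = K'"
proof -
  have K: "finitary K" "K \<subseteq> S" "K' \<subseteq> S"
    using finitary_subset[OF assms] assms(1) by (simp_all add: finitary_def)
  note z = right_factor[OF assms]
  show "len (longest K) \<le> len (longest K')" using z by simp
  assume "len (longest K) = len (longest K')"
  then have "inv (longest K) \<otimes> longest K' = \<one>"
    using z len_eq_0_iff by simp
  then have eq: "longest K' = longest K"
    using K assms by (metis cancel_inv_left(2) longest_closed r_one)
  have "s \<in> K" if s: "s \<in> K'" for s
  proof -
    have S: "s \<in> S" using s K by blast
    have less: "len (s \<otimes> longest K) < len (longest K)"
      using longest_descent[OF assms(1) s] eq by simp
    have "\<exists>b\<in>generate W K. len b < len (longest K) \<and> s \<otimes> (\<one> \<otimes> longest K) = \<one> \<otimes> b"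
      using K less S longest_in[OF K(1)] by (intro exchange_product_left) auto
    then obtain b where b: "b \<in> generate W K" "s \<otimes> longest K = \<one> \<otimes> b"
      using K by auto
    have "b \<in> carrier W" using b K by auto
    then have "s = b \<otimes> inv (longest K)"
      using b S K by (metis S_carrier cancel_inv_right(1) l_one longest_closed)
    then have "s \<in> generate W K"
      using generate_mult[OF b(1) generate_inv[OF K(2) longest_in[OF K(1)]]] by simp
    then show ?thesis using generate_len_1 K S by simp
  qed
  then show "K = K'" using assms by blast
qed

text \<open>The heart of the proof: the length that is lost when \<open>M\<close> is multiplied by \<open>z\<close> is
  \<open>(\<ell> x - \<ell> u) + (\<ell> w\<^bsub>K'\<^esub> - \<ell> w\<^sub>K)\<close>, a sum of two nonnegative terms.\<close>
lemma enlarge_step: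
  assumes "finitary J" "finitary I'" "I \<subseteq> I'" "M \<in> carrier W" "bimaximal J I M"
  defines "x \<equiv> min_elt (double_coset J I M)" and "u \<equiv> min_elt (double_coset J I' M)"
  shows "len (star M (inv (longest I) \<otimes> longest I')) = len M + len (inv (longest I) \<otimes> longest I')
    \<longleftrightarrow> x = u \<and> coset_redundancy J I x = coset_redundancy J I' u"
proof -
  let ?z = "inv (longest I) \<otimes> longest I'" and ?M' = "max_elt (double_coset J I' M)"
  let ?K = "coset_redundancy J I x" and ?K' = "coset_redundancy J I' u"
  have I: "finitary I" using finitary_subset assms by blast
  have S: "J \<subseteq> S" "I \<subseteq> S" "I' \<subseteq> S" using assms by (auto simp: finitary_def)
  have K': "finitary ?K'" using finitary_subset[OF assms(1)] by blast
  have x: "x \<in> double_coset J I M" "biminimal J I x"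
    using min_elt_double_coset[OF S(1,2) assms(4)] by (auto simp: x_def)
  have u: "u \<in> double_coset J I' M" "biminimal J I' u"
    using min_elt_double_coset[OF S(1,3) assms(4)] by (auto simp: u_def)
  have xc: "x \<in> carrier W" and uc: "u \<in> carrier W" using x u by (auto simp: biminimal_def)
  have M': "?M' \<in> double_coset J I' M" "bimaximal J I' ?M'"
    using max_elt_double_coset[OF assms(1,2,4)] by auto
  have "M \<in> double_coset J I x"
    using double_coset_sym[OF S(1,2) assms(4) x(1)] .
  then have lenM: "len M + len (longest ?K) = len (longest J) + len x + len (longest I)"
    using bimaximal_formula(2)[OF assms(1) I x(2)] assms(5) unfolding double_coset_iff bimaximal_def by blast
  have "?M' \<in> double_coset J I' u"
    using double_coset_eq[OF S(1,3) assms(4) u(1)] M' by simp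
  then have lenM': "len ?M' + len (longest ?K') = len (longest J) + len u + len (longest I')"
    using bimaximal_formula(2)[OF assms(1,2) u(2)] M'(2) unfolding double_coset_iff bimaximal_def by blast
  have "x \<in> double_coset J I' u"
    using double_coset_eq[OF S(1,3) assms(4) u(1)] double_coset_mono[OF assms(3)] x by blast
  then obtain a b where ab: "a \<in> generate W J" "b \<in> generate W I'" "x = a \<otimes> u \<otimes> b"
    unfolding double_coset_iff by blast
  have "left_minimal J (a \<otimes> u \<otimes> b)" using x ab by (simp add: biminimal_def)
  then obtain c where c: "c \<in> generate W I'" "x = u \<otimes> c"
    using left_minimal_normal_form[OF S(1,3) u(2) ab(1,2)] ab(3) by metis
  have cc: "c \<in> carrier W" using c S by auto
  have lenx: "len x = len u + len c"
    using right_minimal_add[OF S(3) uc _ c(1)] u(2) c(2) by (simp add: biminimal_def)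
  have KK': "?K \<subseteq> ?K'"
    using redundancy_mono[OF S(1) assms(3) S(3) u(2) c(1)] unfolding c(2) .
  note mono = longest_len_mono[OF K' KK']
  note z = right_factor(2)[OF assms(2,3)]
  have "len ?M' = len M + len ?z \<longleftrightarrow> len c = 0 \<and> len (longest ?K) = len (longest ?K')"
    using lenM lenM' lenx mono(1) z by linarith
  also have "\<dots> \<longleftrightarrow> x = u \<and> ?K = ?K'"
  proof -
    have "len c = 0 \<longleftrightarrow> x = u"
      using c cc uc len_eq_0_iff lenx by auto
    moreover have "len (longest ?K) = len (longest ?K') \<longleftrightarrow> ?K = ?K'"
      using mono(2) by metis
    ultimately show ?thesis by blast
  qed
  finally show ?thesis
    using max_elt_enlarge[OF assms(1-5)] by simp
qed

section \<open>Singular expressions and their forward paths\<close>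

lemma foldr_star_closed [simp]:
  "set xs \<subseteq> carrier W \<Longrightarrow> foldr star xs \<one> \<in> carrier W"
  by (induction xs) auto

lemma foldr_star_append:
  "\<lbrakk>set xs \<subseteq> carrier W; set ys \<subseteq> carrier W\<rbrakk> \<Longrightarrow>
    foldr star (xs @ ys) \<one> = star (foldr star xs \<one>) (foldr star ys \<one>)"
  by (induction xs) (auto simp: star_assoc)

lemma foldr_star_len:
  assumes "set xs \<subseteq> carrier W"
  shows "len (foldr star xs \<one>) \<le> sum_list (map len xs)"
    and "len (foldr star xs \<one>) = sum_list (map len xs) \<Longrightarrow> foldr star xs \<one> = word_prod xs"
proof -
  have "len (foldr star xs \<one>) \<le> sum_list (map len xs) \<and>
    (len (foldr star xs \<one>) = sum_list (map len xs) \<longrightarrow> foldr star xs \<one> = word_prod xs)"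
    using assms
  proof (induction xs)
    case (Cons x xs)
    let ?y = "foldr star xs \<one>"
    have c: "x \<in> carrier W" "?y \<in> carrier W" using Cons.prems by auto
    have IH: "len ?y \<le> sum_list (map len xs)"
      "len ?y = sum_list (map len xs) \<Longrightarrow> ?y = word_prod xs"
      using Cons by auto
    have le: "len (star x ?y) \<le> len x + len ?y" using star_len_le c by blast
    show ?case
    proof (intro conjI impI)
      show "len (foldr star (x # xs) \<one>) \<le> sum_list (map len (x # xs))"
        using IH le by simp
      assume "len (foldr star (x # xs) \<one>) = sum_list (map len (x # xs))"
      then have "len ?y = sum_list (map len xs)" "len (star x ?y) = len x + len ?y"
        using IH le by auto
      then show "foldr star (x # xs) \<one> = word_prod (x # xs)"
        using IH star_eq_mult[OF c] by simp
    qed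
  qed simp
  then show "len (foldr star xs \<one>) \<le> sum_list (map len xs)"
    "len (foldr star xs \<one>) = sum_list (map len xs) \<Longrightarrow> foldr star xs \<one> = word_prod xs"
    by blast+
qed

lemma singular_expression_finitary: "\<lbrakk>singular_expression d I; i \<le> d\<rbrakk> \<Longrightarrow> finitary (I i)"
  by (simp add: singular_expression_def)

lemma singular_expression_step:
  assumes "singular_expression d I" "i < d"
  obtains "I i \<subset> I (Suc i)" | "I (Suc i) \<subset> I i"
proof -
  obtain s where "s \<notin> I i \<and> I (Suc i) = insert s (I i) \<or> s \<in> I i \<and> I (Suc i) = I i - {s}"
    using assms unfolding singular_expression_def by blast
  then show ?thesis using that by blast
qed

lemma y_factor_increasing: "\<lbrakk>finitary (I i); I i \<subset> I (Suc i)\<rbrakk> \<Longrightarrow> y_factor I i = \<one>"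
  by (simp add: y_factor_def Int_absorb2 less_imp_le r_inv del: longest_inv)

lemma z_factor_decreasing: "\<lbrakk>finitary (I (Suc i)); I (Suc i) \<subset> I i\<rbrakk> \<Longrightarrow> z_factor I (Suc i) = \<one>"
  by (simp add: z_factor_def Int_absorb1 less_imp_le l_inv del: longest_inv)

lemma z_factor_increasing:
  "I i \<subset> I (Suc i) \<Longrightarrow> z_factor I (Suc i) = inv (longest (I i)) \<otimes> longest (I (Suc i))"
  by (simp add: z_factor_def Int_absorb2 less_imp_le)

lemma y_factor_decreasing:
  "I (Suc i) \<subset> I i \<Longrightarrow> y_factor I i = longest (I i) \<otimes> inv (longest (I (Suc i)))"
  by (simp add: y_factor_def Int_absorb1 less_imp_le)

lemma y_factor_closed:
  "\<lbrakk>singular_expression d I; i < d\<rbrakk> \<Longrightarrow> y_factor I i \<in> carrier W"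
  unfolding y_factor_def
  using finitary_subset[of "I i" "I i \<inter> I (Suc i)"] singular_expression_finitary[of d I i]
  by (intro m_closed inv_closed longest_closed) auto

lemma z_factor_closed:
  "\<lbrakk>singular_expression d I; i \<le> d\<rbrakk> \<Longrightarrow> z_factor I i \<in> carrier W"
  unfolding z_factor_def
  using finitary_subset[of "I i" "I (i - 1) \<inter> I i"] singular_expression_finitary[of d I i]
  by (intro m_closed inv_closed longest_closed) auto

lemma factors_closed:
  assumes "singular_expression d I" "k \<le> d"
  shows "set (factors d I k) \<subseteq> carrier W"
  using assms y_factor_closed z_factor_closed singular_expression_finitary
  by (auto simp: factors_def)

lemma lengths_add_iff:
  assumes "singular_expression d I" "k \<le> d"
  shows "lengths_add d I k \<longleftrightarrow> len (a_elt d I k) = sum_list (map len (factors d I k))"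
  using foldr_star_len(2)[OF factors_closed[OF assms]] unfolding lengths_add_def a_elt_def by blast

text \<open>Both products are the longest element of the larger one of the two parabolic subgroups:
  one of the outer factors \<open>y\<close>, \<open>z\<close> is the unit, the other one completes the longest element of the
  smaller subgroup.\<close>
lemma shift_factor:
  assumes "singular_expression d I" "k < d"
  shows "star (longest (I k)) (z_factor I (Suc k)) = star (y_factor I k) (longest (I (Suc k)))"
    and "len (longest (I k)) + len (z_factor I (Suc k)) = len (y_factor I k) + len (longest (I (Suc k)))"
proof -
  have fin: "finitary (I k)" "finitary (I (Suc k))"
    using assms singular_expression_finitary by auto
  have "star (longest (I k)) (z_factor I (Suc k)) = star (y_factor I k) (longest (I (Suc k))) \<and>
    len (longest (I k)) + len (z_factor I (Suc k)) = len (y_factor I k) + len (longest (I (Suc k)))"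
    using assms
  proof (cases rule: singular_expression_step)
    case 1
    then show ?thesis
      using right_factor[OF fin(2), of "I k"] fin
      by (simp add: y_factor_increasing z_factor_increasing less_imp_le del: longest_inv)
  next
    case 2
    then show ?thesis
      using left_factor[OF fin(1), of "I (Suc k)"] fin
      by (simp add: y_factor_decreasing z_factor_decreasing less_imp_le del: longest_inv)
  qed
  then show "star (longest (I k)) (z_factor I (Suc k)) = star (y_factor I k) (longest (I (Suc k)))"
    "len (longest (I k)) + len (z_factor I (Suc k)) = len (y_factor I k) + len (longest (I (Suc k)))"
    by blast+
qed

lemma a_elt_shift:
  assumes "singular_expression d I" "k < d"
  shows "a_elt d I k = a_elt d I (Suc k)"
    and "sum_list (map len (factors d I k)) = sum_list (map len (factors d I (Suc k)))"
proof -
  define ys zs where "ys = map (y_factor I) [0..<k]" and "zs = map (z_factor I) [Suc (Suc k)..<Suc d]"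
  have f: "factors d I k = ys @ [longest (I k), z_factor I (Suc k)] @ zs"
    "factors d I (Suc k) = ys @ [y_factor I k, longest (I (Suc k))] @ zs"
    using assms(2) upt_conv_Cons[of "Suc k" "Suc d"]
    by (simp_all add: factors_def ys_def zs_def upt_Suc_append del: upt_Suc)
  have closed: "set (factors d I k) \<subseteq> carrier W" "set (factors d I (Suc k)) \<subseteq> carrier W"
    using factors_closed assms by auto
  have c: "set ys \<subseteq> carrier W" "set zs \<subseteq> carrier W"
    "set [longest (I k), z_factor I (Suc k)] \<subseteq> carrier W"
    "set [y_factor I k, longest (I (Suc k))] \<subseteq> carrier W"
    using closed unfolding f by auto
  have "a_elt d I k = star (foldr star ys \<one>) (star (foldr star [longest (I k), z_factor I (Suc k)] \<one>) (foldr star zs \<one>))"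
    unfolding a_elt_def f using c by (simp add: foldr_star_append star_assoc)
  also have "foldr star [longest (I k), z_factor I (Suc k)] \<one> = foldr star [y_factor I k, longest (I (Suc k))] \<one>"
    using shift_factor(1)[OF assms] c by simp
  also have "star (foldr star ys \<one>) (star \<dots> (foldr star zs \<one>)) = a_elt d I (Suc k)"
    unfolding a_elt_def f using c by (simp add: foldr_star_append star_assoc)
  finally show "a_elt d I k = a_elt d I (Suc k)" .
  show "sum_list (map len (factors d I k)) = sum_list (map len (factors d I (Suc k)))"
    unfolding f using shift_factor(2)[OF assms] by simp
qed

lemma lengths_add_indep:
  assumes "singular_expression d I" "k \<le> d"
  shows "lengths_add d I k \<longleftrightarrow> lengths_add d I 0"
  using assms(2)
proof (induction k)
  case (Suc k)
  then show ?case
    using a_elt_shift[OF assms(1), of k] lengths_add_iff[OF assms(1)] by simp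
qed simp

text \<open>Representing each coset by the maximal element of its predecessor treats growing and shrinking
  subsets alike.\<close>
lemma forward_path_Suc:
  assumes "singular_expression d I" "i < d" "x \<in> carrier W"
    and p: "forward_path I i = double_coset (I 0) (I i) x"
  defines "M \<equiv> max_elt (forward_path I i)"
  shows "M \<in> carrier W" "bimaximal (I 0) (I i) M"
    "forward_path I i = double_coset (I 0) (I i) M"
    "forward_path I (Suc i) = double_coset (I 0) (I (Suc i)) M"
proof -
  have fin: "finitary (I 0)" "finitary (I i)" "finitary (I (Suc i))"
    using assms singular_expression_finitary by auto
  have S: "I 0 \<subseteq> S" "I i \<subseteq> S" "I (Suc i) \<subseteq> S"
    using fin by (auto simp: finitary_def)
  have M: "M \<in> double_coset (I 0) (I i) x" "bimaximal (I 0) (I i) M"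
    using max_elt_double_coset[OF fin(1,2) assms(3)] p by (auto simp: M_def)
  show "bimaximal (I 0) (I i) M" by (rule M)
  show Mc: "M \<in> carrier W"
    using double_coset_closed[OF S(1,2) assms(3) M(1)] .
  show pM: "forward_path I i = double_coset (I 0) (I i) M"
    using double_coset_eq[OF S(1,2) assms(3) M(1)] p by simp
  show "forward_path I (Suc i) = double_coset (I 0) (I (Suc i)) M"
  proof (cases "I i \<subset> I (Suc i)")
    case True
    then show ?thesis
      using the_double_coset_superset[OF S(1) _ S(3) Mc, of "I i"] pM by (simp add: less_imp_le)
  next
    case False
    then show ?thesis
      using the_double_coset[OF S(1,3) Mc] by (simp add: M_def)
  qed
qed

lemma forward_path_double_coset:
  assumes "singular_expression d I" "i \<le> d"
  shows "\<exists>x\<in>carrier W. forward_path I i = double_coset (I 0) (I i) x"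
  using assms(2)
proof (induction i)
  case 0
  have "I 0 \<subseteq> S" using singular_expression_finitary[OF assms(1)] by (auto simp: finitary_def)
  then show ?case
    using the_double_coset[of "I 0" "I 0" \<one>] by auto
next
  case (Suc i)
  then obtain x where "x \<in> carrier W" "forward_path I i = double_coset (I 0) (I i) x" by auto
  then show ?case
    using forward_path_Suc[OF assms(1), of i x] Suc.prems by auto
qed

text \<open>If the subset shrinks, the maximal element stays bimaximal and the factor is the unit. If it
  grows, \<open>max_elt_enlarge\<close> and \<open>enlarge_step\<close> apply.\<close>
lemma max_elt_forward_path_Suc:
  assumes "singular_expression d I" "i < d"
  defines "M \<equiv> max_elt (forward_path I i)" and "M' \<equiv> max_elt (forward_path I (Suc i))"
  shows "M' = star M (z_factor I (Suc i))"
    and "len M' \<le> len M + len (z_factor I (Suc i))"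
    and "len M' = len M + len (z_factor I (Suc i)) \<longleftrightarrow>
      (I i \<subset> I (Suc i) \<longrightarrow>
        min_elt (forward_path I i) = min_elt (forward_path I (Suc i)) \<and>
        left_redundancy I i = left_redundancy I (Suc i))"
proof -
  have fin: "finitary (I 0)" "finitary (I i)" "finitary (I (Suc i))"
    using assms singular_expression_finitary by auto
  obtain x where x: "x \<in> carrier W" "forward_path I i = double_coset (I 0) (I i) x"
    using forward_path_double_coset[of d I i] assms by auto
  note path = forward_path_Suc[OF assms(1,2) x, folded M_def]
  have zc: "z_factor I (Suc i) \<in> carrier W"
    using z_factor_closed assms by simp
  have "M' = star M (z_factor I (Suc i)) \<and>
    (len M' = len M + len (z_factor I (Suc i)) \<longleftrightarrow>
      (I i \<subset> I (Suc i) \<longrightarrow>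
        min_elt (forward_path I i) = min_elt (forward_path I (Suc i)) \<and>
        left_redundancy I i = left_redundancy I (Suc i)))"
    using assms(1,2)
  proof (cases rule: singular_expression_step)
    case 1
    then have sub: "I i \<subseteq> I (Suc i)" by blast
    have M': "M' = star M (z_factor I (Suc i))"
      using max_elt_enlarge[OF fin(1,3) sub path(1,2)] path(4) z_factor_increasing[of I, OF 1]
      by (simp add: M'_def)
    then show ?thesis
      using enlarge_step[OF fin(1,3) sub path(1,2)] 1
      unfolding left_redundancy_def Let_def path(4) path(3) z_factor_increasing[of I, OF 1] by blast
  next
    case 2
    have "bimaximal (I 0) (I (Suc i)) M"
      using path(2) 2 by (auto simp: bimaximal_def)
    moreover have "M \<in> double_coset (I 0) (I (Suc i)) M"
      using double_coset_self[OF path(1)] .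
    ultimately have "M' = M"
      using bimaximal_unique[OF fin(1,3) path(1)] max_elt_double_coset[OF fin(1,3) path(1)] path(4)
      unfolding M'_def by metis
    then show ?thesis
      using z_factor_decreasing[of I, OF fin(3) 2] path(1) 2 by auto
  qed
  then show M': "M' = star M (z_factor I (Suc i))"
    and "len M' = len M + len (z_factor I (Suc i)) \<longleftrightarrow>
      (I i \<subset> I (Suc i) \<longrightarrow>
        min_elt (forward_path I i) = min_elt (forward_path I (Suc i)) \<and>
        left_redundancy I i = left_redundancy I (Suc i))"
    by blast+
  show "len M' \<le> len M + len (z_factor I (Suc i))"
    unfolding M' using star_len_le[OF path(1) zc] .
qed

lemma max_elt_forward_path_0:
  assumes "finitary (I 0)"
  shows "max_elt (forward_path I 0) = longest (I 0)"
proof -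
  let ?w = "longest (I 0)"
  have S: "I 0 \<subseteq> S" using assms by (auto simp: finitary_def)
  have p: "forward_path I 0 = double_coset (I 0) (I 0) \<one>"
    using the_double_coset[OF S S one_closed] by simp
  have "?w = ?w \<otimes> \<one> \<otimes> \<one>" using assms by simp
  then have "?w \<in> double_coset (I 0) (I 0) \<one>"
    unfolding double_coset_iff using longest_in[OF assms] generate.one[of W "I 0"] by metis
  moreover have "bimaximal (I 0) (I 0) ?w"
    using longest_descent longest_right_descent assms by (simp add: bimaximal_def)
  ultimately show ?thesis
    using bimaximal_unique[OF assms assms one_closed] max_elt_double_coset[OF assms assms one_closed]
    unfolding p by metis
qed

text \<open>The partial products for \<open>k = 0\<close> are the maximal elements along the path. A step never
  gains more length than its factor has, so the total is attained exactly if it is attained in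
  every step, and this is reducedness.\<close>
lemma reduced_expression_iff_len:
  assumes "singular_expression d I" "n \<le> d"
  shows "a_elt n I 0 = max_elt (forward_path I n)"
    and "reduced_expression n I \<longleftrightarrow> len (a_elt n I 0) = sum_list (map len (factors n I 0))"
proof -
  have "a_elt n I 0 = max_elt (forward_path I n) \<and>
    len (a_elt n I 0) \<le> sum_list (map len (factors n I 0)) \<and>
    (reduced_expression n I \<longleftrightarrow> len (a_elt n I 0) = sum_list (map len (factors n I 0)))"
    using assms(2)
  proof (induction n)
    case 0
    have "finitary (I 0)" using singular_expression_finitary assms by blast
    then show ?case
      by (simp add: a_elt_def factors_def reduced_expression_def max_elt_forward_path_0
          del: forward_path.simps)
  next
    case (Suc n)
    let ?z = "z_factor I (Suc n)"
    have n: "n < d" "n \<le> d" using Suc.prems by auto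
    note IH = Suc.IH[OF n(2)]
    note step = max_elt_forward_path_Suc[OF assms(1) n(1)]
    have f: "factors (Suc n) I 0 = factors n I 0 @ [?z]"
      by (simp add: factors_def)
    have "singular_expression n I"
      using assms(1) n by (simp add: singular_expression_def)
    then have c: "set (factors n I 0) \<subseteq> carrier W" "?z \<in> carrier W"
      using factors_closed z_factor_closed assms Suc.prems by auto
    have a: "a_elt (Suc n) I 0 = max_elt (forward_path I (Suc n))"
      unfolding step(1) using IH c by (simp add: a_elt_def f foldr_star_append del: forward_path.simps)
    have red: "reduced_expression (Suc n) I \<longleftrightarrow> reduced_expression n I \<and>
      len (max_elt (forward_path I (Suc n))) = len (max_elt (forward_path I n)) + len ?z"
      unfolding step(3) reduced_expression_def less_Suc_eq by blast
    have sum: "sum_list (map len (factors (Suc n) I 0)) = sum_list (map len (factors n I 0)) + len ?z"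
      unfolding f by simp
    show ?case
      using IH step(2) unfolding a red sum by (auto simp del: forward_path.simps)
  qed
  then show "a_elt n I 0 = max_elt (forward_path I n)"
    "reduced_expression n I \<longleftrightarrow> len (a_elt n I 0) = sum_list (map len (factors n I 0))"
    by blast+
qed

lemma reduced_expression_iff_lengths_add:
  assumes "singular_expression d I" "k \<le> d"
  shows "reduced_expression d I \<longleftrightarrow> lengths_add d I k"
  using reduced_expression_iff_len(2)[OF assms(1), of d] lengths_add_iff[OF assms(1), of 0]
    lengths_add_indep[OF assms] by simp

end

theorem theorem3p6:
  fixes W :: "('a, 'b) monoid_scheme" and S :: "'a set"
    and I :: "nat \<Rightarrow> 'a set" and d :: nat
  assumes "coxeter_system W S"
    and "coxeter_system.singular_expression W S d I"
  shows "(coxeter_system.reduced_expression W S d I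
            \<longleftrightarrow> (\<exists>k\<le>d. coxeter_system.lengths_add W S d I k)) \<and>
         (coxeter_system.reduced_expression W S d I
            \<longleftrightarrow> (\<forall>k\<le>d. coxeter_system.lengths_add W S d I k))"
proof -
  interpret coxeter_system W S by (rule assms(1))
  show ?thesis
    using reduced_expression_iff_lengths_add[OF assms(2)] by blast
qed

end
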